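(* Let $d,n\ge 2$ and let $f$ be a $(d,n)$-stable update function (with respect to the interaction distribution $\mathcal D$), where $\mathcal D$ has full support on $\Omega$. Let $\mathcal U^{(0)}$ be a configuration of $n$ opinions in $\mathbb S^{d-1}$ which is not separable. Then $\mathcal U^{(t)}$ almost surely polarizes.
   Context: Model: fix integers $d,n\ge 2$. An opinion is a unit vector in $\mathbb R^d$; a configuration is an $n$-tuple $\mathcal U=(\vec u_1,\dots,\vec u_n)$, and $A_{ij}:=\langle \vec u_i,\vec u_j\rangle$. An update function is $f:[-1,1]\to\mathbb R$. Let $\Omega=\{(i,j)\in[n]^2: i\ne j\}$, $\mathcal D$ a probability distribution on $\Omega$ (full support: every element has positive probability), $I^{(1)},I^{(2)},\dots$ i.i.d. with law $\mathcal D$. If the interaction at step $t$ is $(i,j)$ then $\vec u_k^{(t+1)}=\vec u_k^{(t)}$ for $k\ne i$ and $\vec u_i^{(t+1)}=\vec w/\|\vec w\|$ with $\vec w=\vec u_i^{(t)}+f(A_{ij}^{(t)})\vec u_j^{(t)}$. Polarized: for all $i,j$, $\vec u_i=\pm\vec u_j$; $\mathcal U^{(t)}$ polarizes if $\lim_t\mathcal U^{(t)}$ exists and is polarized. $f$ is stable if continuous and $\operatorname{sign} f(A)=\operatorname{sign}A$ for all $A$. Separable: $[n]$ partitions into nonempty $S,T$ with $\vec u_i\perp\vec u_j$ for $i\in S,j\in T$. For $0\le\varepsilon<1$, two opinions are $\varepsilon$-active if $\varepsilon<|A_{ij}|<1-\varepsilon$; a configuration is $\varepsilon$-active if some pair is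 $\varepsilon$-active, otherwise $\varepsilon$-inactive. For an $\varepsilon$-inactive configuration, a nonempty $C\subseteq[n]$ is a cluster if $|A_{ij}|\ge 1-\varepsilon$ for all $i,j\in C$ and $|A_{ij}|\le\varepsilon$ for $i\in C$, $j\notin C$ (for $\varepsilon\le 1/256$ the clusters form a unique partition of $[n]$). $f$ is $(d,n)$-stable if $f$ is stable and there exist $\varepsilon,p>0$ such that: whenever $\mathcal U^{(0)}$ is an $\varepsilon$-inactive, non-separable configuration of $n$ opinions in $\mathbb S^{d-1}$ with $k\ge 2$ clusters, then almost surely there exists $t$ with $\mathcal U^{(t)}$ $\varepsilon$-active, and, letting $t$ be the first such time, with probability at least $p$ there exist two agents $i,j$ which are in different clusters of $\mathcal U^{(t-1)}$ and satisfy $|A_{ij}^{(t)}|>\varepsilon$. *)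

theory Defs
  imports "HOL-Probability.Probability"
begin

text \<open>Agents are indexed by natural numbers i < n; a configuration is a map
  from agent indices to vectors in R^d (only indices below n matter).\<close>

type_synonym 'd config = "nat \<Rightarrow> real ^ 'd"

definition Agr :: "'d::finite config \<Rightarrow> nat \<Rightarrow> nat \<Rightarrow> real" where
  "Agr U i j = U i \<bullet> U j"

definition is_config :: "nat \<Rightarrow> 'd::finite config \<Rightarrow> bool" where
  "is_config n U \<longleftrightarrow> (\<forall>i<n. norm (U i) = 1)"

definition Omega :: "nat \<Rightarrow> (nat \<times> nat) set" where
  "Omega n = {(i, j). i < n \<and> j < n \<and> i \<noteq> j}"

definition update :: "(real \<Rightarrow> real) \<Rightarrow> nat \<times> nat \<Rightarrow> 'd::finite config \<Rightarrow> 'd config" where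
  "update f ij U =
     (let i = fst ij; j = snd ij; w = U i + f (Agr U i j) *\<^sub>R U j
      in U(i := (1 / norm w) *\<^sub>R w))"

text \<open>Trajectory driven by a sequence of interactions; \<open>\<omega> t\<close> is the interaction
  I^(t+1) used in the step from time t to time t+1.\<close>
fun traj :: "(real \<Rightarrow> real) \<Rightarrow> 'd::finite config \<Rightarrow> (nat \<Rightarrow> nat \<times> nat) \<Rightarrow> nat \<Rightarrow> 'd config" where
  "traj f U \<omega> 0 = U"
| "traj f U \<omega> (Suc t) = update f (\<omega> t) (traj f U \<omega> t)"

definition interactions :: "(nat \<times> nat) pmf \<Rightarrow> (nat \<Rightarrow> nat \<times> nat) measure" where
  "interactions D = (\<Pi>\<^sub>M t\<in>(UNIV :: nat set). measure_pmf D)"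

definition polarized :: "nat \<Rightarrow> 'd::finite config \<Rightarrow> bool" where
  "polarized n U \<longleftrightarrow> (\<forall>i<n. \<forall>j<n. U i = U j \<or> U i = - U j)"

definition polarizes :: "nat \<Rightarrow> (nat \<Rightarrow> 'd::finite config) \<Rightarrow> bool" where
  "polarizes n X \<longleftrightarrow>
     (\<exists>L. (\<forall>i<n. (\<lambda>t. X t i) \<longlonglongrightarrow> L i) \<and> polarized n L)"

definition stable_fun :: "(real \<Rightarrow> real) \<Rightarrow> bool" where
  "stable_fun f \<longleftrightarrow> continuous_on {-1..1} f \<and> (\<forall>A\<in>{-1..1}. sgn (f A) = sgn A)"

definition separable :: "nat \<Rightarrow> 'd::finite config \<Rightarrow> bool" where
  "separable n U \<longleftrightarrow>
     (\<exists>S T. S \<noteq> {} \<and> T \<noteq> {} \<and> S \<inter> T = {} \<and> S \<union> T = {..<n} \<and>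
            (\<forall>i\<in>S. \<forall>j\<in>T. Agr U i j = 0))"

definition eps_active :: "real \<Rightarrow> nat \<Rightarrow> 'd::finite config \<Rightarrow> bool" where
  "eps_active \<epsilon> n U \<longleftrightarrow>
     (\<exists>i<n. \<exists>j<n. \<epsilon> < \<bar>Agr U i j\<bar> \<and> \<bar>Agr U i j\<bar> < 1 - \<epsilon>)"

definition is_cluster :: "real \<Rightarrow> nat \<Rightarrow> 'd::finite config \<Rightarrow> nat set \<Rightarrow> bool" where
  "is_cluster \<epsilon> n U C \<longleftrightarrow>
     C \<noteq> {} \<and> C \<subseteq> {..<n} \<and>
     (\<forall>i\<in>C. \<forall>j\<in>C. \<bar>Agr U i j\<bar> \<ge> 1 - \<epsilon>) \<and>
     (\<forall>i\<in>C. \<forall>j\<in>{..<n} - C. \<bar>Agr U i j\<bar> \<le> \<epsilon>)"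

definition clusters :: "real \<Rightarrow> nat \<Rightarrow> 'd::finite config \<Rightarrow> nat set set" where
  "clusters \<epsilon> n U = {C. is_cluster \<epsilon> n U C}"

definition diff_clusters :: "real \<Rightarrow> nat \<Rightarrow> 'd::finite config \<Rightarrow> nat \<Rightarrow> nat \<Rightarrow> bool" where
  "diff_clusters \<epsilon> n U i j \<longleftrightarrow>
     (\<exists>C\<in>clusters \<epsilon> n U. \<exists>C'\<in>clusters \<epsilon> n U. C \<noteq> C' \<and> i \<in> C \<and> j \<in> C')"

definition dn_stable :: "'d::finite itself \<Rightarrow> nat \<Rightarrow> (nat \<times> nat) pmf \<Rightarrow> (real \<Rightarrow> real) \<Rightarrow> bool" where
  "dn_stable _ n D f \<longleftrightarrow> stable_fun f \<and>
    (\<exists>\<epsilon> p. \<epsilon> > 0 \<and> p > 0 \<and>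
      (\<forall>U :: 'd config. is_config n U \<and> \<not> eps_active \<epsilon> n U \<and> \<not> separable n U
          \<and> card (clusters \<epsilon> n U) \<ge> 2 \<longrightarrow>
        (AE \<omega> in interactions D. \<exists>t. eps_active \<epsilon> n (traj f U \<omega> t)) \<and>
        measure (interactions D)
          {\<omega> \<in> space (interactions D).
             \<exists>t. eps_active \<epsilon> n (traj f U \<omega> t) \<and>
                 (\<forall>s<t. \<not> eps_active \<epsilon> n (traj f U \<omega> s)) \<and>
                 (\<exists>i<n. \<exists>j<n. diff_clusters \<epsilon> n (traj f U \<omega> (t - 1)) i j \<and>
                    \<epsilon> < \<bar>Agr (traj f U \<omega> t) i j\<bar>)} \<ge> p))"

end

theory Submission
  imports Defs
begin

text \<open>Fix \<open>\<epsilon>\<close> from the stability hypothesis and a much smaller \<open>\<eta>\<close>. Let k be the number of components of the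
  graph of pairs with agreement above \<open>\<eta>\<close>. A word of bounded length contracts each component to
  a tight bundle of lines. If two bundles then agree by more than \<open>\<eta>\<close>, the number of components has
  dropped. Otherwise the configuration is inactive, and since f is continuous with f(0) = 0, agents of
  different bundles barely move each other: the bundles persist until two of them agree by more
  than \<open>\<eta>\<close>. Hence the event of probability p in the stability hypothesis forces a drop of k.
  By induction on k, from every non-separable configuration all agreements come within \<open>\<delta>\<close> of 1 in absolute
  value with probability bounded below, hence almost surely, for every \<open>\<delta>\<close>. Narrow double
  cones are invariant, so the opinions converge up to sign to a common vector. Passing from \<open>\<epsilon>\<close>
  to \<open>\<eta>\<close> makes every \<open>\<epsilon> < 1/2\<close> work, although clusters need not partition the agents
  unless \<open>\<epsilon>\<close> is small.\<close>

section \<open>Hitting probabilities\<close>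

lemma space_interactions [simp]: "space (interactions D) = UNIV"
  by (simp add: interactions_def space_PiM)

lemma prob_space_interactions: "prob_space (interactions D)"
  unfolding interactions_def by (intro prob_space_PiM measure_pmf.prob_space_axioms)

text \<open>This supplies the Markov property: an independent first draw followed by a copy of the
  sequence has the law of the sequence itself.\<close>

lemma interactions_iter:
  "distr (measure_pmf D \<Otimes>\<^sub>M interactions D) (interactions D) (\<lambda>(x, \<omega>). case_nat x \<omega>) = interactions D"
proof -
  interpret sequence_space "measure_pmf D"
    by (intro sequence_space.intro product_prob_space.intro product_prob_space_axioms.intro
        product_sigma_finite.intro) unfold_locales
  show ?thesis
    unfolding interactions_def by (rule PiM_iter)
qed

lemma case_nat_measurable:
  "(\<lambda>(x, \<omega>). case_nat x \<omega>) \<in> measurable (measure_pmf D \<Otimes>\<^sub>M interactions D) (interactions D)"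
  unfolding interactions_def
proof (rule measurable_PiM_single')
  fix i :: nat
  show "(\<lambda>y. (case y of (x, \<omega>) \<Rightarrow> case_nat x \<omega>) i)
      \<in> measurable (measure_pmf D \<Otimes>\<^sub>M (\<Pi>\<^sub>M t\<in>UNIV. measure_pmf D)) (measure_pmf D)"
    by (cases i) (simp_all add: split_beta')
qed (auto simp: space_PiM)

text \<open>Fubini for the splitting into the first interaction and the remaining ones; finite
  support turns the outer integral into a sum. The first-step equations for hitting probabilities
  come from here.\<close>

lemma measure_interactions_first_step:
  assumes A: "A \<in> sets (interactions D)" and fin: "finite (set_pmf D)"
  shows "measure (interactions D) A =
    (\<Sum>x\<in>set_pmf D. pmf D x * measure (interactions D) {\<omega>. case_nat x \<omega> \<in> A})"
proof -
  let ?S = "interactions D"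
  interpret S: prob_space ?S by (rule prob_space_interactions)
  let ?g = "\<lambda>(x, \<omega>). case_nat x \<omega>"
  let ?B = "?g -` A \<inter> space (measure_pmf D \<Otimes>\<^sub>M ?S)"
  have B: "?B \<in> sets (measure_pmf D \<Otimes>\<^sub>M ?S)"
    using case_nat_measurable A by (rule measurable_sets)
  have "emeasure ?S A = emeasure (distr (measure_pmf D \<Otimes>\<^sub>M ?S) ?S ?g) A"
    by (simp only: interactions_iter)
  also have "\<dots> = emeasure (measure_pmf D \<Otimes>\<^sub>M ?S) ?B"
    by (rule emeasure_distr[OF case_nat_measurable A])
  also have "\<dots> = (\<integral>\<^sup>+x. emeasure ?S (Pair x -` ?B) \<partial>measure_pmf D)"
    by (rule S.emeasure_pair_measure_alt[OF B])
  also have "\<dots> = (\<integral>\<^sup>+x. ennreal (measure ?S {\<omega>. case_nat x \<omega> \<in> A}) \<partial>measure_pmf D)"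
    by (intro nn_integral_cong) (auto simp: S.emeasure_eq_measure space_pair_measure vimage_def)
  also have "\<dots> = ennreal (\<integral>x. measure ?S {\<omega>. case_nat x \<omega> \<in> A} \<partial>measure_pmf D)"
    using fin by (intro nn_integral_eq_integral integrable_measure_pmf_finite) auto
  finally have "measure ?S A = (\<integral>x. measure ?S {\<omega>. case_nat x \<omega> \<in> A} \<partial>measure_pmf D)"
    by (simp add: S.emeasure_eq_measure integral_nonneg_AE)
  also have "\<dots> = (\<Sum>x\<in>set_pmf D. pmf D x * measure ?S {\<omega>. case_nat x \<omega> \<in> A})"
    using fin by (subst integral_measure_pmf[of "set_pmf D"]) auto
  finally show ?thesis .
qed

text \<open>Up to a fixed time only finitely many interactions matter, each from a countable set, so
  the discrete sigma-algebra can serve as target. Hence every predicate on configurations defines an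
  event.\<close>

lemma traj_measurable:
  "(\<lambda>\<omega>. traj f U \<omega> t) \<in> measurable (interactions D) (count_space UNIV)"
proof (induction t)
  case (Suc t)
  have 1: "(\<lambda>\<omega>. \<omega> t) \<in> measurable (interactions D) (count_space UNIV)"
    unfolding interactions_def
    using measurable_component_singleton[of t UNIV "\<lambda>_. measure_pmf D"] by simp
  have "(\<lambda>\<omega>. update f x (traj f U \<omega> t)) \<in> measurable (interactions D) (count_space UNIV)" for x
    by (rule measurable_compose[OF Suc]) simp
  then show ?case
    using measurable_compose_countable[of "\<lambda>x \<omega>. update f x (traj f U \<omega> t)", OF _ 1] by simp
qed simp

lemma traj_event_sets: "{\<omega>. P (traj f U \<omega> t)} \<in> sets (interactions D)"
proof -
  have "(\<lambda>\<omega>. traj f U \<omega> t) -` {V. P V} \<inter> space (interactions D) \<in> sets (interactions D)"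
    by (rule measurable_sets[OF traj_measurable]) simp
  then show ?thesis by (simp add: vimage_def)
qed

lemma traj_case_nat:
  "traj f U (case_nat x \<omega>) (Suc t) = traj f (update f x U) \<omega> t"
  by (induction t) simp_all

text \<open>The finite horizon \<open>T\<close> gives inductions something to run on; statements
  about \<open>hit\<close> follow in the limit through \<open>hit_by_tendsto\<close>.\<close>

definition hit_by where
  "hit_by f D G T U = measure (interactions D) {\<omega>. \<exists>t\<le>T. G (traj f U \<omega> t)}"

definition hit where
  "hit f D G U = measure (interactions D) {\<omega>. \<exists>t. G (traj f U \<omega> t)}"

lemma hit_by_sets: "{\<omega>. \<exists>t\<le>T. G (traj f U \<omega> t)} \<in> sets (interactions D)"
proof -
  have "{\<omega>. \<exists>t\<le>T. G (traj f U \<omega> t)} = (\<Union>t\<in>{..T}. {\<omega>. G (traj f U \<omega> t)})" by auto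
  then show ?thesis by (simp only:) (intro sets.finite_UN traj_event_sets finite_atMost)
qed

lemma hit_sets: "{\<omega>. \<exists>t. G (traj f U \<omega> t)} \<in> sets (interactions D)"
proof -
  have "{\<omega>. \<exists>t. G (traj f U \<omega> t)} = (\<Union>t. {\<omega>. G (traj f U \<omega> t)})" by auto
  then show ?thesis by (simp only:) (intro sets.countable_UN'' traj_event_sets, simp)
qed

lemma hit_le_1: "hit f D G U \<le> 1"
  unfolding hit_def by (rule prob_space.prob_le_1[OF prob_space_interactions])

lemma hit_nonneg: "0 \<le> hit f D G U"
  by (simp add: hit_def)

lemma hit_now: "G U \<Longrightarrow> hit f D G U = 1"
proof -
  assume "G U"
  then have "{\<omega>. \<exists>t. G (traj f U \<omega> t)} = space (interactions D)"
    by (auto intro!: exI[of _ 0])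
  then show ?thesis
    unfolding hit_def using prob_space.prob_space[OF prob_space_interactions] by metis
qed

lemma hit_by_now: "G U \<Longrightarrow> hit_by f D G T U = 1"
proof -
  assume "G U"
  then have "{\<omega>. \<exists>t\<le>T. G (traj f U \<omega> t)} = space (interactions D)"
    by (auto intro!: exI[of _ 0])
  then show ?thesis
    unfolding hit_by_def using prob_space.prob_space[OF prob_space_interactions] by metis
qed

lemma hit_by_0: "\<not> G U \<Longrightarrow> hit_by f D G 0 U = 0"
  by (simp add: hit_by_def)

text \<open>Without a hit at time 0, the trajectory hits exactly when the one restarted after the
  first interaction does.\<close>

lemma hit_step:
  assumes "finite (set_pmf D)" "\<not> G U"
  shows "hit f D G U = (\<Sum>x\<in>set_pmf D. pmf D x * hit f D G (update f x U))"
proof -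
  have "(\<exists>t. G (traj f U (case_nat x \<omega>) t)) \<longleftrightarrow> (\<exists>t. G (traj f (update f x U) \<omega> t))" for x \<omega>
    using assms(2) by (metis not0_implies_Suc traj.simps(1) traj_case_nat)
  then show ?thesis
    unfolding hit_def by (subst measure_interactions_first_step[OF hit_sets assms(1)]) simp
qed

lemma hit_by_step:
  assumes "finite (set_pmf D)" "\<not> G U"
  shows "hit_by f D G (Suc T) U = (\<Sum>x\<in>set_pmf D. pmf D x * hit_by f D G T (update f x U))"
proof -
  have "(\<exists>t\<le>Suc T. G (traj f U (case_nat x \<omega>) t)) \<longleftrightarrow> (\<exists>t\<le>T. G (traj f (update f x U) \<omega> t))" for x \<omega>
    using assms(2) by (metis Suc_le_mono not0_implies_Suc traj.simps(1) traj_case_nat)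
  then show ?thesis
    unfolding hit_by_def by (subst measure_interactions_first_step[OF hit_by_sets assms(1)]) simp
qed

lemma hit_by_tendsto: "(\<lambda>T. hit_by f D G T U) \<longlonglongrightarrow> hit f D G U"
proof -
  interpret S: prob_space "interactions D" by (rule prob_space_interactions)
  have "(\<lambda>T. measure (interactions D) {\<omega>. \<exists>t\<le>T. G (traj f U \<omega> t)})
    \<longlonglongrightarrow> measure (interactions D) (\<Union>T. {\<omega>. \<exists>t\<le>T. G (traj f U \<omega> t)})"
    using hit_by_sets
    by (intro S.finite_Lim_measure_incseq) (auto simp: incseq_def intro: order_trans)
  moreover have "(\<Union>T. {\<omega>. \<exists>t\<le>T. G (traj f U \<omega> t)}) = {\<omega>. \<exists>t. G (traj f U \<omega> t)}" by auto
  ultimately show ?thesis by (simp add: hit_by_def hit_def)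
qed

lemma hit_after:
  assumes fin: "finite (set_pmf D)" and x: "x \<in> set_pmf D"
  shows "pmf D x * hit f D G (update f x U) \<le> hit f D G U"
proof (cases "G U")
  case True
  then show ?thesis
    by (simp add: hit_now hit_le_1 hit_nonneg mult_le_one pmf_le_1)
next
  case False
  then show ?thesis
    unfolding hit_step[where G = G, OF fin False]
    using member_le_sum[of x "set_pmf D" "\<lambda>x. pmf D x * hit f D G (update f x U)"] fin x
    by (simp add: hit_nonneg)
qed

lemma hit_after_word:
  assumes fin: "finite (set_pmf D)" and "set w \<subseteq> set_pmf D"
    and c: "\<And>x. x \<in> set_pmf D \<Longrightarrow> c \<le> pmf D x" "0 \<le> c"
  shows "c ^ length w * hit f D G (fold (update f) w U) \<le> hit f D G U"
  using assms(2)
proof (induction w arbitrary: U)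
  case (Cons x w)
  let ?V = "update f x U"
  have "c ^ length (x # w) * hit f D G (fold (update f) (x # w) U)
    = c * (c ^ length w * hit f D G (fold (update f) w ?V))" by simp
  also have "\<dots> \<le> c * hit f D G ?V"
    using Cons c by (intro mult_left_mono) auto
  also have "\<dots> \<le> pmf D x * hit f D G ?V"
    using Cons c by (intro mult_right_mono hit_nonneg) auto
  also have "\<dots> \<le> hit f D G U" using Cons.prems by (intro hit_after[OF fin]) simp
  finally show ?case .
qed simp

text \<open>The constant is the least weight of \<open>D\<close> on its support, to the power
  \<open>L\<close>. It depends on neither the word, the configuration nor the target, so lower
  bounds obtained with it are uniform.\<close>

lemma hit_after_bounded_word:
  assumes fin: "finite (set_pmf D)"
  shows "\<exists>c>0. \<forall>w (U :: 'd::finite config) G. set w \<subseteq> set_pmf D \<longrightarrow> length w \<le> L \<longrightarrow>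
    c * hit f D G (fold (update f) w U) \<le> hit f D G U"
proof -
  define c where "c = Min (pmf D ` set_pmf D)"
  have c: "c \<le> pmf D x" if "x \<in> set_pmf D" for x using that fin by (simp add: c_def)
  have "c \<in> pmf D ` set_pmf D"
    unfolding c_def using fin set_pmf_not_empty by (intro Min_in) auto
  then have c0: "0 < c" "c \<le> 1" by (auto simp: pmf_positive pmf_le_1)
  have "c ^ L * hit f D G (fold (update f) w U) \<le> hit f D G U"
    if "set w \<subseteq> set_pmf D" "length w \<le> L" for w G and U :: "'d config"
  proof -
    have "c ^ L * hit f D G (fold (update f) w U) \<le> c ^ length w * hit f D G (fold (update f) w U)"
      using c0 that by (intro mult_right_mono power_decreasing hit_nonneg) auto
    also have "\<dots> \<le> hit f D G U" using hit_after_word[OF fin that(1) c] c0 by simp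
    finally show ?thesis .
  qed
  then show ?thesis using c0 by (intro exI[of _ "c ^ L"]) auto
qed

text \<open>An inequality form of the strong Markov property: wait for \<open>G\<close>, then
  restart there and reach \<open>H\<close> with probability at least \<open>q\<close>. Induction on
  the horizon takes the place of stopping times.\<close>

lemma hit_trans:
  assumes fin: "finite (set_pmf D)"
    and inv: "\<And>x V. x \<in> set_pmf D \<Longrightarrow> I V \<Longrightarrow> I (update f x V)"
    and q: "\<And>V. I V \<Longrightarrow> G V \<Longrightarrow> q \<le> hit f D H V" and q0: "0 \<le> q"
    and U: "I U"
  shows "q * hit f D G U \<le> hit f D H U"
proof -
  have *: "q * hit_by f D G T U \<le> hit f D H U" if "I U" for T U
    using that
  proof (induction T arbitrary: U)
    case 0
    then show ?case by (cases "G U") (auto simp: hit_by_now q hit_by_0 hit_nonneg)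
  next
    case (Suc T)
    consider "G U" | "H U" "\<not> G U" | "\<not> G U" "\<not> H U" by blast
    then show ?case
    proof cases
      case 1
      then show ?thesis using Suc by (simp add: hit_by_now q)
    next
      \<comment> \<open>\<open>H\<close> holds at once, so the right side is 1, while the left side
        is an average of numbers at most 1.\<close>
      case 2
      have "q * hit_by f D G T (update f x U) \<le> 1" if "x \<in> set_pmf D" for x
        using Suc.IH[of "update f x U"] inv[OF that Suc.prems] hit_le_1 order_trans by blast
      then have "(\<Sum>x\<in>set_pmf D. pmf D x * (q * hit_by f D G T (update f x U)))
          \<le> (\<Sum>x\<in>set_pmf D. pmf D x * 1)"
        by (intro sum_mono mult_left_mono) auto
      also have "\<dots> = 1" using fin by (simp add: sum_pmf_eq_1)
      finally show ?thesis
        using 2 by (simp add: hit_by_step[where G = G, OF fin] hit_now sum_distrib_left mult.left_commute)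
    next
      case 3
      have "(\<Sum>x\<in>set_pmf D. pmf D x * (q * hit_by f D G T (update f x U)))
          \<le> (\<Sum>x\<in>set_pmf D. pmf D x * hit f D H (update f x U))"
        using Suc inv by (intro sum_mono mult_left_mono) auto
      then show ?thesis
        using 3 by (simp add: hit_by_step[where G = G, OF fin] hit_step[where G = H, OF fin] sum_distrib_left mult.left_commute)
    qed
  qed
  have "(\<lambda>T. q * hit_by f D G T U) \<longlonglongrightarrow> q * hit f D G U"
    by (intro tendsto_intros hit_by_tendsto)
  then show ?thesis using *[OF U] by (intro LIMSEQ_le_const2) auto
qed

text \<open>Conditionally on no hit up to time T, the failure probability is still at most 1 - q, so
  the failure probability b satisfies b \<open>\<le>\<close> (1 - q) b.\<close>

lemma hit_eq_1:
  assumes fin: "finite (set_pmf D)"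
    and inv: "\<And>x V. x \<in> set_pmf D \<Longrightarrow> I V \<Longrightarrow> I (update f x V)"
    and q: "\<And>V. I V \<Longrightarrow> q \<le> hit f D G V" and q0: "0 < q"
    and U: "I U"
  shows "hit f D G U = 1"
proof -
  have *: "1 - hit f D G U \<le> (1 - q) * (1 - hit_by f D G T U)" if "I U" for T U
    using that
  proof (induction T arbitrary: U)
    case 0
    then show ?case by (cases "G U") (auto simp: hit_by_now hit_now q hit_by_0)
  next
    case (Suc T)
    show ?case
    proof (cases "G U")
      case True
      then show ?thesis by (simp add: hit_by_now hit_now)
    next
      case False
      have s: "(\<Sum>x\<in>set_pmf D. pmf D x) = 1" using fin by (simp add: sum_pmf_eq_1)
      have e: "1 - (\<Sum>x\<in>set_pmf D. pmf D x * h x) = (\<Sum>x\<in>set_pmf D. pmf D x * (1 - h x))" for h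
        by (simp add: algebra_simps sum_subtractf s)
      have "(\<Sum>x\<in>set_pmf D. pmf D x * (1 - hit f D G (update f x U)))
          \<le> (\<Sum>x\<in>set_pmf D. pmf D x * ((1 - q) * (1 - hit_by f D G T (update f x U))))"
        using Suc inv by (intro sum_mono mult_left_mono) auto
      then show ?thesis
        unfolding hit_by_step[where G = G, OF fin False] hit_step[where G = G, OF fin False] e
        by (simp add: sum_distrib_left mult.left_commute)
    qed
  qed
  have "(\<lambda>T. (1 - q) * (1 - hit_by f D G T U)) \<longlonglongrightarrow> (1 - q) * (1 - hit f D G U)"
    by (intro tendsto_intros hit_by_tendsto)
  then have "1 - hit f D G U \<le> (1 - q) * (1 - hit f D G U)"
    using *[OF U] by (intro LIMSEQ_le_const) auto
  then have "q * (1 - hit f D G U) \<le> 0" by (simp add: algebra_simps)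
  then have "1 \<le> hit f D G U" using q0 by (simp add: mult_le_0_iff)
  then show ?thesis using hit_le_1 by (intro antisym)
qed

lemma hit_1_AE:
  assumes "hit f D G U = 1"
  shows "AE \<omega> in interactions D. \<exists>t. G (traj f U \<omega> t)"
proof -
  interpret S: prob_space "interactions D" by (rule prob_space_interactions)
  have "AE \<omega> in interactions D. \<omega> \<in> {\<omega>. \<exists>t. G (traj f U \<omega> t)}"
    using assms unfolding hit_def by (subst S.AE_in_set_eq_1[OF hit_sets])
  then show ?thesis by simp
qed

lemma AE_interactions_in_support: "AE \<omega> in interactions D. \<forall>t. \<omega> t \<in> set_pmf D"
proof -
  have "AE \<omega> in interactions D. \<omega> t \<in> set_pmf D" for t
    unfolding interactions_def
    by (rule AE_PiM_component) (auto intro: measure_pmf.prob_space_axioms simp: AE_measure_pmf)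
  then show ?thesis by (simp add: AE_all_countable)
qed

section \<open>A single interaction\<close>

abbreviation pre_norm :: "(real \<Rightarrow> real) \<Rightarrow> 'd::finite config \<Rightarrow> nat \<Rightarrow> nat \<Rightarrow> real" where
  "pre_norm f U i j \<equiv> norm (U i + f (Agr U i j) *\<^sub>R U j)"

lemma update_other: "k \<noteq> i \<Longrightarrow> update f (i, j) U k = U k"
  by (simp add: update_def Let_def)

lemma update_same: "update f (i, j) U i = (1 / pre_norm f U i j) *\<^sub>R (U i + f (Agr U i j) *\<^sub>R U j)"
  by (simp add: update_def Let_def)

lemma update_inner:
  "update f (i, j) U i \<bullet> y = (U i \<bullet> y + f (Agr U i j) * (U j \<bullet> y)) / pre_norm f U i j"
  by (simp add: update_same inner_add_left)

lemma Agr_commute: "Agr U i j = Agr U j i"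
  by (simp add: Agr_def inner_commute)

lemma Agr_update_other: "k \<noteq> i \<Longrightarrow> l \<noteq> i \<Longrightarrow> Agr (update f (i, j) U) k l = Agr U k l"
  by (simp add: Agr_def update_other)

lemma Agr_update:
  "k \<noteq> i \<Longrightarrow> Agr (update f (i, j) U) i k
    = (Agr U i k + f (Agr U i j) * Agr U j k) / pre_norm f U i j"
  by (simp add: Agr_def update_inner update_other)

lemma Agr_self: "is_config n U \<Longrightarrow> i < n \<Longrightarrow> Agr U i i = 1"
  by (simp add: is_config_def Agr_def dot_square_norm)

lemma Agr_bound: "is_config n U \<Longrightarrow> i < n \<Longrightarrow> j < n \<Longrightarrow> \<bar>Agr U i j\<bar> \<le> 1"
  using Cauchy_Schwarz_ineq2[of "U i" "U j"] by (simp add: is_config_def Agr_def)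

lemma stable_fun_sgn: "stable_fun f \<Longrightarrow> \<bar>A\<bar> \<le> 1 \<Longrightarrow> sgn (f A) = sgn A"
  unfolding stable_fun_def using abs_le_D1[of A 1] abs_le_D2[of A 1] by auto

lemma stable_fun_zero: "stable_fun f \<Longrightarrow> f 0 = 0"
  using stable_fun_sgn[of f 0] by (simp add: sgn_zero_iff)

lemma stable_fun_mult: "stable_fun f \<Longrightarrow> \<bar>A\<bar> \<le> 1 \<Longrightarrow> f A * A = \<bar>f A\<bar> * \<bar>A\<bar>"
  using stable_fun_sgn[of f A] by (cases A "0 :: real" rule: linorder_cases) (auto simp: sgn_1_pos sgn_1_neg)

lemma stable_fun_mult_nonneg: "stable_fun f \<Longrightarrow> \<bar>A\<bar> \<le> 1 \<Longrightarrow> 0 \<le> f A * A"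
  by (simp add: stable_fun_mult)

lemma pre_norm_sq:
  assumes "is_config n U" "i < n" "j < n"
  shows "(pre_norm f U i j)\<^sup>2 = 1 + 2 * (f (Agr U i j) * Agr U i j) + (f (Agr U i j))\<^sup>2"
proof -
  have 1: "U i \<bullet> U i = 1" "U j \<bullet> U j = 1"
    using assms by (simp_all add: is_config_def dot_square_norm)
  show ?thesis
    unfolding power2_norm_eq_inner Agr_def
    by (simp add: 1 inner_commute[of "U j" "U i"] inner_add_left inner_add_right algebra_simps power2_eq_square)
qed

text \<open>An agreement and its value under \<open>f\<close> have equal signs, so the cross term in
  \<open>pre_norm_sq\<close> is nonnegative. Normalization therefore never divides by zero.\<close>

lemma pre_norm_ge_1:
  assumes "stable_fun f" "is_config n U" "i < n" "j < n"
  shows "1 \<le> pre_norm f U i j"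
proof -
  have "1\<^sup>2 \<le> (pre_norm f U i j)\<^sup>2"
    using stable_fun_mult_nonneg[OF assms(1) Agr_bound[OF assms(2-4)]]
    by (simp add: pre_norm_sq[OF assms(2-4)])
  then show ?thesis by (rule power2_le_imp_le) simp
qed

lemma pre_norm_le:
  assumes "is_config n U" "i < n" "j < n"
  shows "pre_norm f U i j \<le> 1 + \<bar>f (Agr U i j)\<bar>"
  using norm_triangle_ineq[of "U i" "f (Agr U i j) *\<^sub>R U j"] assms by (simp add: is_config_def)

lemma is_config_update:
  assumes "stable_fun f" "is_config n U" "i < n" "j < n"
  shows "is_config n (update f (i, j) U)"
  using pre_norm_ge_1[OF assms] assms(2)
  by (auto simp: is_config_def update_def Let_def)

lemma is_config_fold:
  "stable_fun f \<Longrightarrow> is_config n U \<Longrightarrow> set w \<subseteq> Omega n \<Longrightarrow> is_config n (fold (update f) w U)"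
  by (induction w arbitrary: U) (auto simp: Omega_def intro!: is_config_update)

text \<open>One minus the squared agreement is the squared area of the parallelogram spanned by the
  two unit vectors. Adding a multiple of \<open>U j\<close> to \<open>U i\<close> preserves this
  area, so only the normalization changes it.\<close>

lemma Agr_update_partner:
  assumes f: "stable_fun f" and U: "is_config n U" and ij: "i < n" "j < n" "i \<noteq> j"
  shows "1 - (Agr (update f (i, j) U) i j)\<^sup>2 = (1 - (Agr U i j)\<^sup>2) / (pre_norm f U i j)\<^sup>2"
proof -
  let ?N = "pre_norm f U i j" and ?A = "Agr U i j"
  have N: "?N \<noteq> 0" using pre_norm_ge_1[OF f U ij(1,2)] by linarith
  have "Agr (update f (i, j) U) i j = (?A + f ?A) / ?N"
    using ij Agr_self[OF U ij(2)] by (simp add: Agr_update)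
  then have "1 - (Agr (update f (i, j) U) i j)\<^sup>2 = (?N\<^sup>2 - (?A + f ?A)\<^sup>2) / ?N\<^sup>2"
    using N by (simp add: power_divide diff_divide_distrib)
  also have "?N\<^sup>2 - (?A + f ?A)\<^sup>2 = 1 - ?A\<^sup>2"
    unfolding pre_norm_sq[OF U ij(1,2)] by (simp add: power2_eq_square algebra_simps)
  finally show ?thesis .
qed

text \<open>If \<open>i\<close> and \<open>j\<close> are orthogonal, the step changes nothing.
  Otherwise their agreement stays nonzero, so a separation after the step has both on one side; the
  old \<open>U i\<close> is a combination of the two new vectors, so the same sets separate the old
  configuration.\<close>

lemma not_separable_update:
  assumes f: "stable_fun f" and U: "is_config n U" and ij: "i < n" "j < n" "i \<noteq> j"
    and ns: "\<not> separable n U"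
  shows "\<not> separable n (update f (i, j) U)"
proof
  let ?V = "update f (i, j) U" and ?N = "pre_norm f U i j" and ?A = "Agr U i j"
  assume "separable n ?V"
  then obtain S T where ST: "S \<noteq> {}" "T \<noteq> {}" "S \<inter> T = {}" "S \<union> T = {..<n}"
    and "\<forall>k\<in>S. \<forall>l\<in>T. Agr ?V k l = 0"
    unfolding separable_def by (elim exE conjE)
  then have o: "\<And>k l. k \<in> S \<Longrightarrow> l \<in> T \<Longrightarrow> Agr ?V k l = 0" by simp
  have N: "1 \<le> ?N" by (rule pre_norm_ge_1[OF f U ij(1,2)])
  show False
  proof (cases "?A = 0")
    case True
    have "norm (U i) = 1" using U ij by (simp add: is_config_def)
    then have "?V = U" using True by (simp add: update_def stable_fun_zero[OF f])
    then show False using ns \<open>separable n ?V\<close> by simp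
  next
    case False
    have "Agr ?V i j = (?A + f ?A) / ?N"
      using ij Agr_self[OF U ij(2)] by (simp add: Agr_update)
    moreover have "?A + f ?A \<noteq> 0"
    proof
      assume "?A + f ?A = 0"
      then have "f ?A = - ?A" by linarith
      then have "f ?A * ?A = - (?A * ?A)" by simp
      moreover have "0 \<le> f ?A * ?A" by (rule stable_fun_mult_nonneg[OF f Agr_bound[OF U ij(1,2)]])
      moreover have "0 < ?A * ?A" using False by (metis not_real_square_gt_zero)
      ultimately show False by linarith
    qed
    ultimately have "Agr ?V i j \<noteq> 0" using N by auto
    moreover have "i \<in> S \<or> i \<in> T" "j \<in> S \<or> j \<in> T" using ST(4) ij by auto
    ultimately have same: "i \<in> S \<and> j \<in> S \<or> i \<in> T \<and> j \<in> T"
      using o[of i j] o[of j i] Agr_commute[of ?V i j] by presburger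
    have orth: "Agr U k l = 0"
      if kl: "Agr ?V k l = 0" "k \<noteq> l" and j: "k = i \<Longrightarrow> Agr ?V j l = 0 \<and> l \<noteq> j"
        "l = i \<Longrightarrow> Agr ?V j k = 0 \<and> k \<noteq> j" for k l
    proof -
      have i: "Agr U i m = 0" if "Agr ?V i m = 0" "m \<noteq> i" "Agr ?V j m = 0" for m
        using that N ij by (auto simp: Agr_update Agr_update_other)
      consider "k = i" | "l = i" | "k \<noteq> i" "l \<noteq> i" by blast
      then show ?thesis
      proof cases
        case 1 then show ?thesis using i[of l] kl j by auto
      next
        case 2 then show ?thesis using i[of k] kl j by (simp add: Agr_commute)
      next
        case 3 then show ?thesis using kl by (simp add: Agr_update_other)
      qed
    qed
    have "Agr U k l = 0" if kl: "k \<in> S" "l \<in> T" for k l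
    proof (rule orth)
      show "Agr ?V k l = 0" "k \<noteq> l" using o kl ST(3) by auto
      show "Agr ?V j l = 0 \<and> l \<noteq> j" if "k = i"
      proof -
        have "j \<in> S" using same kl that ST(3) by auto
        then show ?thesis using o kl ST(3) by auto
      qed
      show "Agr ?V j k = 0 \<and> k \<noteq> j" if "l = i"
      proof -
        have "j \<in> T" using same kl that ST(3) by auto
        then show ?thesis using o[of k j] kl ST(3) Agr_commute[of ?V j k] by auto
      qed
    qed
    then have "separable n U" using ST unfolding separable_def by (intro exI[of _ S] exI[of _ T]) auto
    then show False using ns by simp
  qed
qed

section \<open>Tightening clusters\<close>

text \<open>On the compact set of agreements of size at least \<open>\<eta>\<close>,
  \<open>f\<close> has no zero, so its absolute value is at least some \<open>m > 0\<close>. By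
  \<open>Agr_update_partner\<close> each interaction then shrinks one minus the squared agreement by
  the factor \<open>r\<close>, and agreements never leave that set. Compactness is what makes
  \<open>K\<close> uniform.\<close>

lemma interact_repeatedly:
  assumes f: "stable_fun f" and \<eta>: "0 < \<eta>" and \<delta>: "0 < \<delta>"
  shows "\<exists>K. \<forall>(U :: 'd::finite config) i j. is_config n U \<longrightarrow> i < n \<longrightarrow> j < n \<longrightarrow> i \<noteq> j \<longrightarrow> \<eta> \<le> \<bar>Agr U i j\<bar>
    \<longrightarrow> 1 - \<delta> \<le> \<bar>Agr (fold (update f) (replicate K (i, j)) U) i j\<bar>"
proof -
  let ?B = "{-1..-\<eta>} \<union> {\<eta>..1}"
  \<comment> \<open>\<open>?B\<close> is empty when \<open>\<eta> > 1\<close>, so this case is split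
    off before a minimum is taken.\<close>
  have "\<exists>m>0. \<forall>A\<in>?B. m \<le> \<bar>f A\<bar>"
  proof (cases "?B = {}")
    case False
    have "continuous_on ?B f"
      using f \<eta> by (auto simp: stable_fun_def intro: continuous_on_subset)
    then have "continuous_on ?B (\<lambda>A. \<bar>f A\<bar>)" by (intro continuous_intros)
    moreover have "compact ?B" by (intro compact_Un compact_Icc)
    ultimately obtain A where A: "A \<in> ?B" "\<forall>A'\<in>?B. \<bar>f A\<bar> \<le> \<bar>f A'\<bar>"
      using continuous_attains_inf[of ?B "\<lambda>A. \<bar>f A\<bar>"] False by blast
    have "f A \<noteq> 0" using stable_fun_sgn[OF f, of A] A(1) \<eta> by (auto simp: sgn_if split: if_splits)
    then show ?thesis using A(2) by (intro exI[of _ "\<bar>f A\<bar>"]) auto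
  qed (use zero_less_one in blast)
  then obtain m where m: "0 < m" "\<And>A. A \<in> ?B \<Longrightarrow> m \<le> \<bar>f A\<bar>" by blast
  define r where "r = 1 / (1 + m\<^sup>2)"
  have r: "0 < r" "r < 1" using m by (auto simp: r_def add_pos_pos)
  obtain K where K: "r ^ K < \<delta>" using real_arch_pow_inv[OF \<delta> r(2)] by blast
  have "1 - \<delta> \<le> \<bar>Agr (fold (update f) (replicate K (i, j)) U) i j\<bar>"
    if U: "is_config n U" and ij: "i < n" "j < n" "i \<noteq> j" and A0: "\<eta> \<le> \<bar>Agr U i j\<bar>"
    for U :: "'d config" and i j
  proof -
    define X where "X k = (update f (i, j) ^^ k) U" for k
    have X: "is_config n (X k) \<and> \<eta> \<le> \<bar>Agr (X k) i j\<bar> \<and> 1 - (Agr (X k) i j)\<^sup>2 \<le> r ^ k" for k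
    proof (induction k)
      case 0
      then show ?case using U A0 by (simp add: X_def)
    next
      case (Suc k)
      let ?A = "Agr (X k) i j" and ?N = "pre_norm f (X k) i j"
      have Xk: "is_config n (X k)" using Suc by simp
      have step: "X (Suc k) = update f (i, j) (X k)" by (simp add: X_def)
      have le1: "\<bar>?A\<bar> \<le> 1" by (rule Agr_bound[OF Xk ij(1,2)])
      have "?A \<in> ?B" using Suc le1 by auto
      then have "m \<le> \<bar>f ?A\<bar>" by (rule m)
      then have "m\<^sup>2 \<le> (f ?A)\<^sup>2" using m(1) abs_le_square_iff[of m "f ?A"] by simp
      then have N: "1 + m\<^sup>2 \<le> ?N\<^sup>2"
        unfolding pre_norm_sq[OF Xk ij(1,2)] using stable_fun_mult_nonneg[OF f le1] by simp
      have m2: "0 < 1 + m\<^sup>2" by (simp add: add_pos_nonneg)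
      have a2: "0 \<le> 1 - ?A\<^sup>2" using le1 by (simp add: abs_square_le_1)
      have "1 - (Agr (X (Suc k)) i j)\<^sup>2 = (1 - ?A\<^sup>2) / ?N\<^sup>2"
        unfolding step by (rule Agr_update_partner[OF f Xk ij])
      also have "\<dots> \<le> (1 - ?A\<^sup>2) / (1 + m\<^sup>2)"
        using N m2 a2 by (intro divide_left_mono mult_pos_pos) auto
      finally have c: "1 - (Agr (X (Suc k)) i j)\<^sup>2 \<le> r * (1 - ?A\<^sup>2)" by (simp add: r_def)
      also have "\<dots> \<le> 1 * (1 - ?A\<^sup>2)" using r a2 by (intro mult_right_mono) auto
      finally have "\<bar>?A\<bar> \<le> \<bar>Agr (X (Suc k)) i j\<bar>" by (simp add: abs_le_square_iff)
      moreover have "r * (1 - ?A\<^sup>2) \<le> r * r ^ k" using Suc r by (intro mult_left_mono) auto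
      moreover have "is_config n (X (Suc k))" unfolding step by (rule is_config_update[OF f Xk ij(1,2)])
      ultimately show ?case using Suc c by auto
    qed
    have le1: "\<bar>Agr (X K) i j\<bar> \<le> 1" using Agr_bound X ij by blast
    have "1 - \<delta> \<le> (Agr (X K) i j)\<^sup>2" using X[of K] K by linarith
    also have "\<dots> = \<bar>Agr (X K) i j\<bar> * \<bar>Agr (X K) i j\<bar>" by (simp add: power2_eq_square)
    also have "\<dots> \<le> \<bar>Agr (X K) i j\<bar>" using le1 mult_left_le[of "\<bar>Agr (X K) i j\<bar>" "\<bar>Agr (X K) i j\<bar>"] by simp
    finally show ?thesis by (simp add: X_def)
  qed
  then show ?thesis by blast
qed

lemma fold_replicate_update_other: "k \<noteq> i \<Longrightarrow> fold (update f) (replicate K (i, j)) U k = U k"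
  by (induction K arbitrary: U) (simp_all add: update_other del: fold_replicate)

text \<open>The members of \<open>M\<close> interact with \<open>p\<close> one after another. Since
  \<open>p\<close> never moves, earlier contractions are not disturbed, and members still waiting
  keep their initial agreement with \<open>p\<close>.\<close>

lemma gather_at:
  fixes U :: "'d::finite config"
  assumes f: "stable_fun f" and U: "is_config n U"
    and K: "\<And>(U :: 'd config) i j. is_config n U \<Longrightarrow> i < n \<Longrightarrow> j < n \<Longrightarrow> i \<noteq> j \<Longrightarrow> \<eta> \<le> \<bar>Agr U i j\<bar>
      \<Longrightarrow> 1 - \<delta> \<le> \<bar>Agr (fold (update f) (replicate K (i, j)) U) i j\<bar>"
    and M: "finite M" "M \<subseteq> {..<n}" and p: "p < n" "p \<notin> M"
    and near: "\<And>i. i \<in> M \<Longrightarrow> \<eta> \<le> \<bar>Agr U i p\<bar>"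
  shows "\<exists>w. set w \<subseteq> Omega n \<and> length w \<le> card M * K \<and> (\<forall>k. k \<notin> M \<longrightarrow> fold (update f) w U k = U k) \<and>
    (\<forall>i\<in>M. 1 - \<delta> \<le> \<bar>Agr (fold (update f) w U) i p\<bar>)"
  using M p(2) near
proof (induction M rule: finite_induct)
  case empty
  then show ?case by (intro exI[of _ "[]"]) simp
next
  case (insert x M)
  then obtain w where w: "set w \<subseteq> Omega n" "length w \<le> card M * K"
    "\<And>k. k \<notin> M \<Longrightarrow> fold (update f) w U k = U k"
    "\<And>i. i \<in> M \<Longrightarrow> 1 - \<delta> \<le> \<bar>Agr (fold (update f) w U) i p\<bar>" by auto
  let ?V = "fold (update f) w U" and ?w = "w @ replicate K (x, p)"
  let ?W = "fold (update f) ?w U"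
  have V: "is_config n ?V" by (rule is_config_fold[OF f U w(1)])
  have xp: "x < n" "x \<noteq> p" using insert.prems by auto
  have eq: "?V x = U x" "?V p = U p" using insert.hyps insert.prems w(3) by auto
  have far: "?W k = ?V k" if "k \<noteq> x" for k
    using fold_replicate_update_other[OF that, of f K p ?V] by simp
  have "1 - \<delta> \<le> \<bar>Agr ?W x p\<bar>"
    using K[OF V xp(1) p(1) xp(2)] insert.prems(3)[of x] eq by (simp add: Agr_def)
  moreover have "Agr ?W i p = Agr ?V i p" if "i \<noteq> x" for i
    using far[OF that] far[of p] xp by (simp add: Agr_def)
  ultimately have "\<forall>i\<in>insert x M. 1 - \<delta> \<le> \<bar>Agr ?W i p\<bar>" using w(4) by (metis insert_iff)
  moreover have "set ?w \<subseteq> Omega n" using w(1) xp p(1) by (auto simp: Omega_def)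
  moreover have "length ?w \<le> card (insert x M) * K" using insert.hyps w(2) by simp
  moreover have "\<forall>k. k \<notin> insert x M \<longrightarrow> ?W k = U k" using far w(3) by simp
  ultimately show ?case by blast
qed

section \<open>Unit vectors that are nearly parallel up to sign\<close>

lemma norm_diff_sgn_sq:
  fixes u v :: "'a::real_inner"
  assumes "norm u = 1" "norm v = 1"
  shows "(norm (sgn (u \<bullet> v) *\<^sub>R u - v))\<^sup>2 \<le> 2 - 2 * \<bar>u \<bullet> v\<bar>"
proof -
  have 1: "u \<bullet> u = 1" "v \<bullet> v = 1" using assms by (simp_all add: dot_square_norm)
  have "(norm (s *\<^sub>R u - v))\<^sup>2 = s\<^sup>2 + 1 - 2 * (s * (u \<bullet> v))" for s
    unfolding power2_norm_eq_inner
    by (simp add: inner_diff_left inner_diff_right 1 inner_commute[of v u] power2_eq_square algebra_simps)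
  note this[of "sgn (u \<bullet> v)"]
  \<comment> \<open>The sign is 0 for orthogonal vectors, which is why the result is an
    inequality.\<close>
  moreover have "(sgn (u \<bullet> v))\<^sup>2 \<le> 1" by (simp add: sgn_if)
  moreover have "sgn (u \<bullet> v) * (u \<bullet> v) = \<bar>u \<bullet> v\<bar>" by (simp add: sgn_if)
  ultimately show ?thesis by simp
qed

text \<open>After a sign correction \<open>u\<close> lies within \<open>\<gamma>\<close> of
  \<open>v\<close>, and Cauchy-Schwarz bounds the change of the inner product with
  \<open>y\<close>.\<close>

lemma abs_inner_near:
  fixes u v y :: "'a::real_inner"
  assumes u: "norm u = 1" "norm v = 1" "norm y = 1" and \<delta>: "1 - \<delta> \<le> \<bar>u \<bullet> v\<bar>" "2 * \<delta> \<le> \<gamma>\<^sup>2" "0 \<le> \<gamma>" "\<gamma> < 1"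
  shows "\<bar>v \<bullet> y\<bar> - \<gamma> \<le> \<bar>u \<bullet> y\<bar>"
proof -
  define s where "s = sgn (u \<bullet> v)"
  have "(norm (s *\<^sub>R u - v))\<^sup>2 \<le> \<gamma>\<^sup>2"
    using norm_diff_sgn_sq[OF u(1,2)] \<delta>(1,2) unfolding s_def by linarith
  then have "norm (s *\<^sub>R u - v) \<le> \<gamma>" using \<delta>(3) by (rule power2_le_imp_le)
  moreover have "\<bar>(s *\<^sub>R u - v) \<bullet> y\<bar> \<le> norm (s *\<^sub>R u - v)"
    using Cauchy_Schwarz_ineq2[of "s *\<^sub>R u - v" y] u by simp
  ultimately have "\<bar>s * (u \<bullet> y) - v \<bullet> y\<bar> \<le> \<gamma>" by (simp add: inner_diff_left)
  moreover have "\<bar>s * (u \<bullet> y)\<bar> \<le> \<bar>u \<bullet> y\<bar>"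
    by (auto simp: s_def sgn_if abs_mult)
  ultimately show ?thesis by linarith
qed

text \<open>Sign-corrected, both vectors have squared distance at most \<open>2 * \<delta>\<close>
  from \<open>v\<close>, hence at most \<open>8 * \<delta>\<close> from each other; half of that is
  the loss of agreement. For \<open>\<delta> \<ge> 1\<close> the bound is negative and
  trivial.\<close>

lemma abs_inner_common_neighbour:
  fixes u v y :: "'a::real_inner"
  assumes u: "norm u = 1" "norm v = 1" "norm y = 1" and \<delta>: "1 - \<delta> \<le> \<bar>u \<bullet> v\<bar>" "1 - \<delta> \<le> \<bar>y \<bullet> v\<bar>"
  shows "1 - 4 * \<delta> \<le> \<bar>u \<bullet> y\<bar>"
proof -
  define s t where "s = sgn (u \<bullet> v)" and "t = sgn (y \<bullet> v)"
  have 1: "u \<bullet> u = 1" "y \<bullet> y = 1" using u by (simp_all add: dot_square_norm)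
  have uv: "\<bar>u \<bullet> v\<bar> \<le> 1" using Cauchy_Schwarz_ineq2[of u v] u by simp
  have le: "(norm (s *\<^sub>R u - v))\<^sup>2 \<le> 2 * \<delta>" "(norm (t *\<^sub>R y - v))\<^sup>2 \<le> 2 * \<delta>"
    using norm_diff_sgn_sq[OF u(1,2)] norm_diff_sgn_sq[OF u(3,2)] \<delta> by (simp_all add: s_def t_def)
  show ?thesis
  proof (cases "\<delta> < 1")
    case True
    then have st: "s * s = 1" "t * t = 1" using \<delta> by (auto simp: s_def t_def sgn_if)
    have "norm (s *\<^sub>R u - t *\<^sub>R y) \<le> norm (s *\<^sub>R u - v) + norm (t *\<^sub>R y - v)"
      using norm_triangle_ineq4[of "s *\<^sub>R u - v" "t *\<^sub>R y - v"] by simp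
    then have "(norm (s *\<^sub>R u - t *\<^sub>R y))\<^sup>2 \<le> (norm (s *\<^sub>R u - v) + norm (t *\<^sub>R y - v))\<^sup>2"
      by (intro power_mono) auto
    also have "\<dots> \<le> 2 * (norm (s *\<^sub>R u - v))\<^sup>2 + 2 * (norm (t *\<^sub>R y - v))\<^sup>2"
      using zero_le_power2[of "norm (s *\<^sub>R u - v) - norm (t *\<^sub>R y - v)"]
      by (simp add: power2_eq_square algebra_simps)
    also have "\<dots> \<le> 8 * \<delta>" using le by simp
    finally have "(norm (s *\<^sub>R u - t *\<^sub>R y))\<^sup>2 \<le> 8 * \<delta>" .
    moreover have "(norm (s *\<^sub>R u - t *\<^sub>R y))\<^sup>2 = s * s + t * t - 2 * (s * t * (u \<bullet> y))"
      unfolding power2_norm_eq_inner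
      by (simp add: inner_diff_left inner_diff_right 1 inner_commute[of y u] algebra_simps)
    ultimately have "2 - 8 * \<delta> \<le> 2 * (s * t * (u \<bullet> y))" using st by simp
    moreover have "s * t * (u \<bullet> y) \<le> \<bar>u \<bullet> y\<bar>" by (auto simp: s_def t_def sgn_if)
    ultimately show ?thesis by linarith
  qed (use uv in \<open>linarith\<close>)
qed

text \<open>Agents are removed in order of decreasing depth: agent l, together with the agents
  already gathered at l, is moved to its parent p.\<close>

lemma collapse_aux:
  fixes d :: "nat \<Rightarrow> nat" and U :: "'d::finite config"
  assumes f: "stable_fun f" and \<eta>: "0 < \<eta>" "\<eta> \<le> 1" and \<delta>: "0 < \<delta>" "8 * \<delta> \<le> \<eta>\<^sup>2"
    and K: "\<And>(U :: 'd config) i j. is_config n U \<Longrightarrow> i < n \<Longrightarrow> j < n \<Longrightarrow> i \<noteq> j \<Longrightarrow> \<eta> / 2 \<le> \<bar>Agr U i j\<bar>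
      \<Longrightarrow> 1 - \<delta> \<le> \<bar>Agr (fold (update f) (replicate K (i, j)) U) i j\<bar>"
    and "card (X - R) = m" "is_config n U" "R \<subseteq> X" "X \<subseteq> {..<n}"
    and "\<And>i. i \<in> X - R \<Longrightarrow> \<exists>j\<in>X. d j < d i \<and> \<eta> < \<bar>Agr U i j\<bar>"
    and "\<And>i. i < n \<Longrightarrow> a i \<in> X \<and> 1 - \<delta> \<le> \<bar>Agr U i (a i)\<bar>"
    and "\<And>i. i \<in> X \<Longrightarrow> a i = i"
  shows "\<exists>w \<rho>. set w \<subseteq> Omega n \<and> length w \<le> m * (n * K) \<and> (\<forall>r\<in>R. \<rho> r = r) \<and>
    (\<forall>i<n. \<rho> i \<in> R \<and> 1 - \<delta> \<le> \<bar>Agr (fold (update f) w U) i (\<rho> i)\<bar>)"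
  using assms(7-)
proof (induction m arbitrary: X U a)
  case 0
  have "finite X" using 0 finite_subset by blast
  then have "X = R" using 0 by auto
  then show ?case using 0 by (intro exI[of _ "[]"] exI[of _ a]) auto
next
  case (Suc m)
  note X = Suc.prems
  have fin: "finite (X - R)" using Suc.prems(4) finite_subset by blast
  have "X - R \<noteq> {}" using Suc.prems(1) by (metis card.empty Zero_not_Suc)
  \<comment> \<open>Since \<open>l\<close> has maximal depth among the remaining non-roots, it is
    the parent of none of them, so every other non-root keeps its parent when \<open>l\<close> is
    removed.\<close>
  then have "Max (d ` (X - R)) \<in> d ` (X - R)" using fin by (intro Max_in) auto
  then obtain l where l: "l \<in> X - R" "d l = Max (d ` (X - R))" by auto
  have max: "d i \<le> d l" if "i \<in> X - R" for i using that fin l(2) by simp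
  obtain p where p: "p \<in> X" "d p < d l" "\<eta> < \<bar>Agr U l p\<bar>" using X(5)[OF l(1)] by blast
  \<comment> \<open>\<open>a i\<close> is the remaining agent at which \<open>i\<close> has been
    gathered, so \<open>M\<close> is everything located at \<open>l\<close>, including
    \<open>l\<close> itself.\<close>
  define M where "M = {i. i < n \<and> a i = l}"
  have ln: "l < n" "p < n" using l p X(4) by auto
  have M: "finite M" "M \<subseteq> {..<n}" "p \<notin> M" "card M \<le> n"
    using X(7)[OF p(1)] p(2) card_mono[of "{..<n}" M] by (auto simp: M_def)
  \<comment> \<open>Only \<open>l\<close> is known to agree with \<open>p\<close> by more than
    \<open>\<eta>\<close>; the others in \<open>M\<close> are merely close to \<open>l\<close>. Half
    of \<open>\<eta>\<close> pays for this, which explains the threshold in the hypothesis on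
    \<open>K\<close> and the factor 8 in the one on \<open>\<delta>\<close>.\<close>
  have near: "\<eta> / 2 \<le> \<bar>Agr U i p\<bar>" if "i \<in> M" for i
  proof -
    have "i < n" "1 - \<delta> \<le> \<bar>U i \<bullet> U l\<bar>" using that X(6)[of i] by (auto simp: M_def Agr_def)
    moreover have "2 * \<delta> \<le> (\<eta> / 2)\<^sup>2" using \<delta> by (simp add: power_divide)
    ultimately have "\<bar>U l \<bullet> U p\<bar> - \<eta> / 2 \<le> \<bar>U i \<bullet> U p\<bar>"
      using X(2) ln \<eta> by (intro abs_inner_near[where \<delta> = \<delta>]) (auto simp: is_config_def)
    then show ?thesis using p(3) by (simp add: Agr_def)
  qed
  obtain w where w: "set w \<subseteq> Omega n" "length w \<le> card M * K"
      "\<And>k. k \<notin> M \<Longrightarrow> fold (update f) w U k = U k"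
      "\<And>i. i \<in> M \<Longrightarrow> 1 - \<delta> \<le> \<bar>Agr (fold (update f) w U) i p\<bar>"
    using gather_at[OF f X(2) K M(1,2) ln(2) M(3) near] by blast
  define V where "V = fold (update f) w U"
  define X' where "X' = X - {l}"
  define a' where "a' i = (if a i = l then p else a i)" for i
  have notM: "k \<notin> M" if "k \<in> X'" for k
    using that X(7)[of k] by (auto simp: X'_def M_def)
  have VX: "V k = U k" if "k \<in> X'" for k using w(3) notM[OF that] by (simp add: V_def)
  have "\<exists>w' \<rho>. set w' \<subseteq> Omega n \<and> length w' \<le> m * (n * K) \<and> (\<forall>r\<in>R. \<rho> r = r) \<and>
    (\<forall>i<n. \<rho> i \<in> R \<and> 1 - \<delta> \<le> \<bar>Agr (fold (update f) w' V) i (\<rho> i)\<bar>)"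
  proof (rule Suc.IH[of X' V a'])
    have "X' - R = (X - R) - {l}" by (auto simp: X'_def)
    then show "card (X' - R) = m" using fin l(1) X(1) by simp
    show "is_config n V" unfolding V_def by (rule is_config_fold[OF f X(2) w(1)])
    show "R \<subseteq> X'" "X' \<subseteq> {..<n}" using X(3,4) l by (auto simp: X'_def)
    show "\<exists>j\<in>X'. d j < d i \<and> \<eta> < \<bar>Agr V i j\<bar>" if i: "i \<in> X' - R" for i
    proof -
      obtain j where j: "j \<in> X" "d j < d i" "\<eta> < \<bar>Agr U i j\<bar>" using X(5)[of i] i by (auto simp: X'_def)
      moreover have "d i \<le> d l" using max[of i] i by (auto simp: X'_def)
      ultimately have "j \<in> X'" by (auto simp: X'_def)
      then show ?thesis using j VX[of i] VX[of j] i by (auto simp: Agr_def)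
    qed
    show "a' i \<in> X' \<and> 1 - \<delta> \<le> \<bar>Agr V i (a' i)\<bar>" if i: "i < n" for i
    proof (cases "i \<in> M")
      case True
      then have "a' i = p" by (simp add: a'_def M_def)
      moreover have "p \<in> X'" using p by (auto simp: X'_def)
      ultimately show ?thesis using w(4)[OF True] by (simp add: V_def)
    next
      case False
      then have a: "a' i = a i" "a i \<in> X'" using X(6)[OF i] i by (auto simp: a'_def M_def X'_def)
      have "V i = U i" using w(3)[OF False] by (simp add: V_def)
      then show ?thesis using a VX[OF a(2)] X(6)[OF i] by (simp add: Agr_def)
    qed
    show "a' i = i" if "i \<in> X'" for i using that X(7)[of i] by (auto simp: a'_def X'_def)
  qed
  then obtain w' \<rho> where w': "set w' \<subseteq> Omega n" "length w' \<le> m * (n * K)" "\<forall>r\<in>R. \<rho> r = r"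
    "\<forall>i<n. \<rho> i \<in> R \<and> 1 - \<delta> \<le> \<bar>Agr (fold (update f) w' V) i (\<rho> i)\<bar>" by blast
  have "card M * K \<le> n * K" using M(4) by (rule mult_le_mono1)
  then have "length w + length w' \<le> n * K + m * (n * K)" using w(2) w'(2) by linarith
  then have "length (w @ w') \<le> Suc m * (n * K)" by simp
  moreover have "fold (update f) (w @ w') U = fold (update f) w' V" by (simp add: V_def)
  ultimately show ?case
    using w(1) w' by (intro exI[of _ "w @ w'"] exI[of _ \<rho>]) auto
qed

text \<open>The graph of pairs with agreement above \<open>\<eta>\<close> has at most k components: from every agent,
  a path of decreasing depth d leads to one of at most k roots.\<close>

definition rooted_by :: "real \<Rightarrow> nat \<Rightarrow> nat \<Rightarrow> 'd::finite config \<Rightarrow> bool" where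
  "rooted_by \<eta> n k U \<longleftrightarrow> (\<exists>R d. R \<subseteq> {..<n} \<and> card R \<le> k \<and>
     (\<forall>i<n. i \<in> R \<or> (\<exists>j<n. d j < (d i :: nat) \<and> \<eta> < \<bar>Agr U i j\<bar>)))"

lemma rooted_by_all: "rooted_by \<eta> n n U"
  unfolding rooted_by_def by (intro exI[of _ "{..<n}"]) auto

text \<open>An agent of least depth has no parent, so it must be a root.\<close>

lemma not_rooted_by_0:
  assumes "0 < n"
  shows "\<not> rooted_by \<eta> n 0 U"
proof
  assume "rooted_by \<eta> n 0 U"
  then obtain R and d :: "nat \<Rightarrow> nat" where R: "R \<subseteq> {..<n}" "card R \<le> 0"
    "\<forall>i<n. i \<in> R \<or> (\<exists>j<n. d j < d i \<and> \<eta> < \<bar>Agr U i j\<bar>)" unfolding rooted_by_def by blast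
  then have "R = {}" using finite_subset[OF R(1)] by simp
  then have *: "\<exists>j<n. d j < d i" if "i < n" for i using R(3) that by auto
  obtain i where "i < n" "\<forall>j<n. d i \<le> d j"
    using ex_has_least_nat[of "\<lambda>i. i < n" 0 d] assms by blast
  then show False using *[of i] by auto
qed

text \<open>Initially every agent is gathered at itself. There are at most \<open>n\<close>
  removals, each moving at most \<open>n\<close> agents by \<open>K\<close> interactions, so the
  word length is bounded independently of \<open>U\<close>.\<close>

lemma collapse:
  assumes f: "stable_fun f" and \<eta>: "0 < \<eta>" "\<eta> \<le> 1" and \<delta>: "0 < \<delta>" "8 * \<delta> \<le> \<eta>\<^sup>2"
  shows "\<exists>L. \<forall>U :: 'd::finite config. is_config n U \<longrightarrow> rooted_by \<eta> n k U \<longrightarrow>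
    (\<exists>w R \<rho>. set w \<subseteq> Omega n \<and> length w \<le> L \<and> R \<subseteq> {..<n} \<and> card R \<le> k \<and> (\<forall>r\<in>R. \<rho> r = r) \<and>
      (\<forall>i<n. \<rho> i \<in> R \<and> 1 - \<delta> \<le> \<bar>Agr (fold (update f) w U) i (\<rho> i)\<bar>))"
proof -
  obtain K where K: "\<And>(U :: 'd config) i j. is_config n U \<Longrightarrow> i < n \<Longrightarrow> j < n \<Longrightarrow> i \<noteq> j \<Longrightarrow>
      \<eta> / 2 \<le> \<bar>Agr U i j\<bar> \<Longrightarrow> 1 - \<delta> \<le> \<bar>Agr (fold (update f) (replicate K (i, j)) U) i j\<bar>"
    using interact_repeatedly[OF f, of "\<eta> / 2" \<delta> n] \<eta> \<delta>(1) by auto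
  have "\<exists>w R \<rho>. set w \<subseteq> Omega n \<and> length w \<le> n * (n * K) \<and> R \<subseteq> {..<n} \<and> card R \<le> k \<and> (\<forall>r\<in>R. \<rho> r = r) \<and>
      (\<forall>i<n. \<rho> i \<in> R \<and> 1 - \<delta> \<le> \<bar>Agr (fold (update f) w U) i (\<rho> i)\<bar>)"
    if U: "is_config n U" and r: "rooted_by \<eta> n k U" for U :: "'d config"
  proof -
    obtain R and d :: "nat \<Rightarrow> nat" where R: "R \<subseteq> {..<n}" "card R \<le> k"
      "\<forall>i<n. i \<in> R \<or> (\<exists>j<n. d j < d i \<and> \<eta> < \<bar>Agr U i j\<bar>)" using r unfolding rooted_by_def by blast
    have "\<exists>w \<rho>. set w \<subseteq> Omega n \<and> length w \<le> card ({..<n} - R) * (n * K) \<and> (\<forall>r\<in>R. \<rho> r = r) \<and>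
      (\<forall>i<n. \<rho> i \<in> R \<and> 1 - \<delta> \<le> \<bar>Agr (fold (update f) w U) i (\<rho> i)\<bar>)"
    proof (rule collapse_aux[OF f \<eta> \<delta> K refl U R(1), where d = d and a = "\<lambda>i. i"])
      show "\<exists>j\<in>{..<n}. d j < d i \<and> \<eta> < \<bar>Agr U i j\<bar>" if "i \<in> {..<n} - R" for i
        using R(3) that by auto
      show "i \<in> {..<n} \<and> 1 - \<delta> \<le> \<bar>Agr U i i\<bar>" if "i < n" for i
        using that Agr_self[OF U that] \<delta>(1) by simp
    qed auto
    then obtain w \<rho> where w: "set w \<subseteq> Omega n" "length w \<le> card ({..<n} - R) * (n * K)" "\<forall>r\<in>R. \<rho> r = r"
      "\<forall>i<n. \<rho> i \<in> R \<and> 1 - \<delta> \<le> \<bar>Agr (fold (update f) w U) i (\<rho> i)\<bar>" by blast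
    have "card ({..<n} - R) \<le> n" using card_mono[of "{..<n}" "{..<n} - R"] by auto
    then have "card ({..<n} - R) * (n * K) \<le> n * (n * K)" by (rule mult_le_mono1)
    then have "length w \<le> n * (n * K)" using w(2) by linarith
    then show ?thesis using w R by blast
  qed
  then show ?thesis by blast
qed

text \<open>One agreement across two groups lets the group of \<open>j\<close> hang below that of
  \<open>i\<close>: its members lead to their old root, this leads to \<open>j\<close>, then to
  \<open>i\<close>, then to the root of \<open>i\<close>. The old root of \<open>j\<close> is no
  longer counted.\<close>

lemma rooted_by_merge:
  fixes V :: "'d::finite config"
  assumes R: "R \<subseteq> {..<n}" "card R \<le> Suc k" and \<rho>: "\<And>r. r \<in> R \<Longrightarrow> \<rho> r = r" "\<And>i. i < n \<Longrightarrow> \<rho> i \<in> R"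
    and near: "\<And>i. i < n \<Longrightarrow> \<eta> < \<bar>Agr V i (\<rho> i)\<bar>"
    and ij: "i < n" "j < n" "\<rho> i \<noteq> \<rho> j" "\<eta> < \<bar>Agr V i j\<bar>"
  shows "rooted_by \<eta> n k V"
proof -
  let ?r = "\<rho> j"
  \<comment> \<open>Surviving roots get 0 and their members 1; then come \<open>j\<close>, its old
    root and the rest of its group. The test for \<open>j\<close> comes first because
    \<open>j\<close> may be that root.\<close>
  define d :: "nat \<Rightarrow> nat" where "d x = (if x = j then 2 else if x = ?r then 3 else if \<rho> x = ?r then 4
    else if x \<in> R then 0 else 1)" for x
  have r: "?r \<in> R" "?r < n" "\<rho> ?r = ?r" using \<rho> ij(2) R(1) by auto
  have "finite R" using R(1) finite_subset by blast
  then have "card (R - {?r}) \<le> k" using R(2) r(1) by simp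
  moreover have "x \<in> R - {?r} \<or> (\<exists>y<n. d y < d x \<and> \<eta> < \<bar>Agr V x y\<bar>)" if x: "x < n" for x
  proof -
    have root: "\<rho> x \<in> R" "\<rho> x < n" "\<rho> (\<rho> x) = \<rho> x" using \<rho> x R(1) by auto
    consider "x = j" | "x \<noteq> j" "x = ?r" | "x \<noteq> j" "x \<noteq> ?r" "\<rho> x = ?r" | "x \<noteq> j" "\<rho> x \<noteq> ?r" by blast
    then show ?thesis
    proof cases
      case 1
      have "d i \<le> 1" using ij(3) r(3) by (auto simp: d_def)
      then have "d i < d x" using 1 by (simp add: d_def)
      then show ?thesis using 1 ij by (auto simp: Agr_commute)
    next
      case 2
      have "d j < d x" using 2 by (simp add: d_def)
      then show ?thesis using 2 ij(2) near[OF ij(2)] by (auto simp: Agr_commute)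
    next
      case 3
      have "d ?r < d x" using 3 by (simp add: d_def)
      then show ?thesis using 3 r(2) near[OF x] by auto
    next
      case 4
      show ?thesis
      proof (cases "x \<in> R")
        case True
        then show ?thesis using 4 r(3) by auto
      next
        case False
        have "\<rho> x \<noteq> j" using 4 root by auto
        then have "d (\<rho> x) < d x" using 4 False root r by (auto simp: d_def)
        then show ?thesis using near[OF x] root by auto
      qed
    qed
  qed
  ultimately show ?thesis
    unfolding rooted_by_def using R(1) by (intro exI[of _ "R - {?r}"] exI[of _ d]) auto
qed

section \<open>The invariant of the dynamics and the first-activity event\<close>

lemma nonseparable_config_update:
  "stable_fun f \<Longrightarrow> x \<in> Omega n \<Longrightarrow> is_config n V \<and> \<not> separable n V
    \<Longrightarrow> is_config n (update f x V) \<and> \<not> separable n (update f x V)"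
  by (cases x) (simp add: Omega_def is_config_update not_separable_update)

lemma nonseparable_config_fold:
  "stable_fun f \<Longrightarrow> set w \<subseteq> Omega n \<Longrightarrow> is_config n V \<and> \<not> separable n V
    \<Longrightarrow> is_config n (fold (update f) w V) \<and> \<not> separable n (fold (update f) w V)"
proof (induction w arbitrary: V)
  case (Cons x w)
  then show ?case using nonseparable_config_update[of f x n V] by simp
qed simp

lemma eps_inactive_iff:
  "\<not> eps_active \<epsilon> n U \<longleftrightarrow> (\<forall>i<n. \<forall>j<n. \<bar>Agr U i j\<bar> \<le> \<epsilon> \<or> 1 - \<epsilon> \<le> \<bar>Agr U i j\<bar>)"
  unfolding eps_active_def by (meson not_le)

text \<open>The event of \<open>dn_stable\<close>, for an arbitrary sequence of configurations. For
  \<open>t = 0\<close> truncated subtraction makes \<open>X (t - 1)\<close> the initial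
  configuration; an inactive start rules this out.\<close>

definition first_activity_across :: "real \<Rightarrow> nat \<Rightarrow> (nat \<Rightarrow> 'd::finite config) \<Rightarrow> bool" where
  "first_activity_across \<epsilon> n X \<longleftrightarrow> (\<exists>t. eps_active \<epsilon> n (X t) \<and> (\<forall>s<t. \<not> eps_active \<epsilon> n (X s)) \<and>
     (\<exists>i<n. \<exists>j<n. diff_clusters \<epsilon> n (X (t - 1)) i j \<and> \<epsilon> < \<bar>Agr (X t) i j\<bar>))"

lemma is_config_traj:
  assumes "stable_fun f" "is_config n U" "\<And>t. \<omega> t \<in> Omega n"
  shows "is_config n (traj f U \<omega> t)"
proof (induction t)
  case (Suc t)
  obtain i j where "\<omega> t = (i, j)" "i < n" "j < n" using assms(3)[of t] by (auto simp: Omega_def)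
  then show ?case using is_config_update[OF assms(1) Suc] by simp
qed (use assms in simp)

section \<open>Persistence of clusters\<close>

text \<open>With signs \<open>s\<close> and \<open>t\<close> making the first two inner products
  positive, the squared norm of \<open>s a - b + t c\<close> would be negative if the third had the
  wrong sign. Three vectors at mutual angles of 120 degrees show that 1/2 is the right
  threshold.\<close>

lemma inner_triangle_pos:
  fixes a b c :: "'a::real_inner"
  assumes n: "norm a = 1" "norm b = 1" "norm c = 1"
    and h: "1 / 2 < \<bar>a \<bullet> b\<bar>" "1 / 2 < \<bar>b \<bullet> c\<bar>" "1 / 2 < \<bar>a \<bullet> c\<bar>"
  shows "0 < (a \<bullet> b) * (b \<bullet> c) * (a \<bullet> c)"
proof -
  define s t where "s = sgn (a \<bullet> b)" and "t = sgn (b \<bullet> c)"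
  have 1: "a \<bullet> a = 1" "b \<bullet> b = 1" "c \<bullet> c = 1" using n by (simp_all add: dot_square_norm)
  have st: "s * s = 1" "t * t = 1" "s * (a \<bullet> b) = \<bar>a \<bullet> b\<bar>" "t * (b \<bullet> c) = \<bar>b \<bullet> c\<bar>"
    using h by (auto simp: s_def t_def sgn_if)
  have "0 \<le> (s *\<^sub>R a - b + t *\<^sub>R c) \<bullet> (s *\<^sub>R a - b + t *\<^sub>R c)" by (rule inner_ge_zero)
  also have "\<dots> = s * s + 1 + t * t - 2 * (s * (a \<bullet> b)) - 2 * (t * (b \<bullet> c)) + 2 * (s * t * (a \<bullet> c))"
    by (simp add: inner_diff_left inner_diff_right inner_add_left inner_add_right 1
        inner_commute[of b a] inner_commute[of c b] inner_commute[of c a] algebra_simps)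
  finally have "0 \<le> 3 - 2 * \<bar>a \<bullet> b\<bar> - 2 * \<bar>b \<bullet> c\<bar> + 2 * (s * t * (a \<bullet> c))"
    using st by simp
  moreover have "\<bar>s * t * (a \<bullet> c)\<bar> = \<bar>a \<bullet> c\<bar>"
  proof -
    have "\<bar>s\<bar> = 1" "\<bar>t\<bar> = 1" using h by (auto simp: s_def t_def sgn_if)
    then show ?thesis by (simp add: abs_mult)
  qed
  ultimately have "0 < s * t * (a \<bullet> c)" using h by linarith
  moreover have "(a \<bullet> b) * (b \<bullet> c) * (a \<bullet> c) = \<bar>a \<bullet> b\<bar> * \<bar>b \<bullet> c\<bar> * (s * t * (a \<bullet> c))"
  proof -
    have "a \<bullet> b = s * \<bar>a \<bullet> b\<bar>" "b \<bullet> c = t * \<bar>b \<bullet> c\<bar>" by (simp_all add: s_def t_def sgn_mult_abs)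
    then show ?thesis by (metis mult.assoc mult.commute)
  qed
  moreover have "0 < \<bar>a \<bullet> b\<bar> * \<bar>b \<bullet> c\<bar>" using h by (intro mult_pos_pos) linarith+
  ultimately show ?thesis by (metis mult_pos_pos)
qed

lemma abs_add_same_sign: "0 \<le> x * y \<Longrightarrow> \<bar>x + y\<bar> = \<bar>x\<bar> + \<bar>y\<bar>" for x y :: real
  by (auto simp: zero_le_mult_iff)

text \<open>The bound \<open>\<epsilon>\<close> looks weak, but if the next configuration is
  inactive it forces \<open>1 - \<epsilon>\<close> again. Inside a group the pull of
  \<open>j\<close> reinforces agreements, and the gain outweighs the normalization; across groups
  \<open>f\<close> is so small that little changes.\<close>

lemma cluster_persists_step:
  assumes f: "stable_fun f" and V: "is_config n V" and ij: "i < n" "j < n" "i \<noteq> j"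
    and \<epsilon>: "0 < \<epsilon>" "\<epsilon> < 1 / 2" and small: "\<And>A. \<bar>A\<bar> \<le> \<eta> \<Longrightarrow> \<bar>f A\<bar> \<le> (1 - 2 * \<epsilon>) / 4"
    and tight: "\<And>k l. k < n \<Longrightarrow> l < n \<Longrightarrow> \<rho> k = \<rho> l \<Longrightarrow> 1 - \<epsilon> \<le> \<bar>Agr V k l\<bar>"
    and apart: "\<And>k l. k < n \<Longrightarrow> l < n \<Longrightarrow> \<rho> k \<noteq> \<rho> l \<Longrightarrow> \<bar>Agr V k l\<bar> \<le> \<eta>"
    and kl: "k < n" "l < n" "\<rho> k = \<rho> l"
  shows "\<epsilon> < \<bar>Agr (update f (i, j) V) k l\<bar>"
proof -
  let ?N = "pre_norm f V i j" and ?A = "Agr V i j"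
  have N: "1 \<le> ?N" "?N \<le> 1 + \<bar>f ?A\<bar>" by (rule pre_norm_ge_1[OF f V ij(1,2)] pre_norm_le[OF V ij(1,2)])+
  have main: "\<epsilon> < \<bar>Agr (update f (i, j) V) i m\<bar>" if m: "m < n" "\<rho> m = \<rho> i" "m \<noteq> i" for m
  proof -
    have im: "1 - \<epsilon> \<le> \<bar>Agr V i m\<bar>" using tight[of i m] ij m by simp
    have "\<epsilon> * ?N < \<bar>Agr V i m + f ?A * Agr V j m\<bar>"
    proof (cases "\<rho> j = \<rho> i")
      case True
      have fA: "f ?A = \<bar>f ?A\<bar> * sgn ?A"
        using stable_fun_sgn[OF f Agr_bound[OF V ij(1,2)]] by (metis abs_mult_sgn)
      have A: "\<bar>?A\<bar> * sgn ?A = ?A" by (metis sgn_mult_abs mult.commute)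
      have jm: "1 - \<epsilon> \<le> \<bar>Agr V j m\<bar>" and aij: "1 - \<epsilon> \<le> \<bar>?A\<bar>"
        using tight[of j m] tight[of i j] ij m True by simp_all
      \<comment> \<open>Sign consistency within the group: the pull of \<open>j\<close> moves
        \<open>i\<close> towards the line of \<open>m\<close>, so both contributions have the same
        sign.\<close>
      have "0 < ?A * Agr V j m * Agr V i m"
        unfolding Agr_def
        using V ij m im jm aij \<epsilon> by (intro inner_triangle_pos) (auto simp: is_config_def Agr_def)
      moreover have "\<bar>?A\<bar> * (sgn ?A * Agr V j m * Agr V i m) = ?A * Agr V j m * Agr V i m"
        by (simp only: mult.assoc[symmetric] A)
      ultimately have "0 < \<bar>?A\<bar> * (sgn ?A * Agr V j m * Agr V i m)" by (simp only:)
      then have pos: "0 < sgn ?A * Agr V j m * Agr V i m" by (simp add: zero_less_mult_iff)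
      have "Agr V i m * (\<bar>f ?A\<bar> * sgn ?A * Agr V j m) = \<bar>f ?A\<bar> * (sgn ?A * Agr V j m * Agr V i m)"
        by (simp only: mult_ac)
      then have "Agr V i m * (f ?A * Agr V j m) = \<bar>f ?A\<bar> * (sgn ?A * Agr V j m * Agr V i m)"
        by (simp only: fA[symmetric])
      moreover have "0 \<le> \<bar>f ?A\<bar> * (sgn ?A * Agr V j m * Agr V i m)"
        by (rule mult_nonneg_nonneg[OF abs_ge_zero less_imp_le[OF pos]])
      ultimately have "0 \<le> Agr V i m * (f ?A * Agr V j m)" by (simp only:)
      then have "\<bar>Agr V i m + f ?A * Agr V j m\<bar> = \<bar>Agr V i m\<bar> + \<bar>f ?A\<bar> * \<bar>Agr V j m\<bar>"
        by (simp add: abs_add_same_sign abs_mult)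
      also have "\<dots> \<ge> (1 - \<epsilon>) + \<bar>f ?A\<bar> * (1 - \<epsilon>)"
        using im jm by (intro add_mono mult_left_mono) auto
      finally have "(1 - \<epsilon>) * (1 + \<bar>f ?A\<bar>) \<le> \<bar>Agr V i m + f ?A * Agr V j m\<bar>" by (simp add: algebra_simps)
      moreover have "(1 - \<epsilon>) * ?N \<le> (1 - \<epsilon>) * (1 + \<bar>f ?A\<bar>)" using N \<epsilon> by (intro mult_left_mono) auto
      moreover have "\<epsilon> * ?N < (1 - \<epsilon>) * ?N" using N \<epsilon> by (intro mult_strict_right_mono) auto
      ultimately show ?thesis by linarith
    next
      case False
      \<comment> \<open>Needed is \<open>1 - \<epsilon> - \<mu> > \<epsilon> * (1 + \<mu>)\<close>;
        it holds because \<open>4 * \<mu> = 1 - 2 * \<epsilon>\<close> exceeds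
        \<open>\<mu> + \<epsilon> * \<mu>\<close>.\<close>
      define \<mu> where "\<mu> = (1 - 2 * \<epsilon>) / 4"
      have \<mu>: "0 < \<mu>" "\<bar>f ?A\<bar> \<le> \<mu>" using small[OF apart[of i j]] ij False \<epsilon> by (auto simp: \<mu>_def)
      have "\<bar>f ?A * Agr V j m\<bar> \<le> \<mu> * 1"
        unfolding abs_mult using \<mu> Agr_bound[OF V ij(2) m(1)] by (intro mult_mono) auto
      then have "1 - \<epsilon> - \<mu> \<le> \<bar>Agr V i m + f ?A * Agr V j m\<bar>" using im by linarith
      moreover have "\<epsilon> * ?N \<le> \<epsilon> * (1 + \<mu>)" using N \<mu> \<epsilon> by (intro mult_left_mono) auto
      moreover have "\<epsilon> * \<mu> < 1 * \<mu>" using \<epsilon> \<mu> by (intro mult_strict_right_mono) auto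
      moreover have "\<epsilon> * (1 + \<mu>) = \<epsilon> + \<epsilon> * \<mu>" by (simp add: algebra_simps)
      moreover have "4 * \<mu> = 1 - 2 * \<epsilon>" by (simp add: \<mu>_def)
      ultimately show ?thesis using \<mu>(1) by linarith
    qed
    then have "\<epsilon> < \<bar>Agr V i m + f ?A * Agr V j m\<bar> / ?N"
      using less_le_trans[OF zero_less_one N(1)] by (simp only: pos_less_divide_eq)
    then show ?thesis using m by (simp add: Agr_update)
  qed
  consider "k = i" "l = i" | "k = i" "l \<noteq> i" | "k \<noteq> i" "l = i" | "k \<noteq> i" "l \<noteq> i" by blast
  then show ?thesis
  proof cases
    case 1
    then show ?thesis using Agr_self[OF is_config_update[OF f V ij(1,2)] ij(1)] \<epsilon> by simp
  next
    case 2
    then show ?thesis using main[of l] kl by simp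
  next
    case 3
    then show ?thesis using main[of k] kl by (simp add: Agr_commute[of _ k])
  next
    case 4
    then show ?thesis using tight[OF kl] \<epsilon> by (simp add: Agr_update_other)
  qed
qed

text \<open>Suppose the component count never drops. Then the groups of \<open>\<rho>\<close> stay
  tight and apart up to the first active time, and just before it the clusters are exactly these
  groups. An agreement above \<open>\<epsilon>\<close> between two of them would be a merge, a
  contradiction.\<close>

lemma first_activity_merges:
  assumes f: "stable_fun f" and U: "is_config n U" and \<omega>: "\<And>t. \<omega> t \<in> Omega n"
    and \<epsilon>: "0 < \<epsilon>" "\<epsilon> < 1 / 2" and \<eta>: "\<eta> \<le> \<epsilon>"
    and small: "\<And>A. \<bar>A\<bar> \<le> \<eta> \<Longrightarrow> \<bar>f A\<bar> \<le> (1 - 2 * \<epsilon>) / 4"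
    and R: "R \<subseteq> {..<n}" "card R \<le> Suc k" and \<rho>: "\<And>r. r \<in> R \<Longrightarrow> \<rho> r = r" "\<And>i. i < n \<Longrightarrow> \<rho> i \<in> R"
    and tight: "\<And>k l. k < n \<Longrightarrow> l < n \<Longrightarrow> \<rho> k = \<rho> l \<Longrightarrow> 1 - \<epsilon> \<le> \<bar>Agr U k l\<bar>"
    and apart: "\<And>k l. k < n \<Longrightarrow> l < n \<Longrightarrow> \<rho> k \<noteq> \<rho> l \<Longrightarrow> \<bar>Agr U k l\<bar> \<le> \<eta>"
    and act: "first_activity_across \<epsilon> n (traj f U \<omega>)"
  shows "\<exists>s. rooted_by \<eta> n k (traj f U \<omega> s)"
proof (rule ccontr)
  let ?X = "traj f U \<omega>"
  assume no: "\<nexists>s. rooted_by \<eta> n k (?X s)"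
  obtain t i j where t: "eps_active \<epsilon> n (?X t)" "\<forall>s<t. \<not> eps_active \<epsilon> n (?X s)"
    and ij: "i < n" "j < n" "diff_clusters \<epsilon> n (?X (t - 1)) i j" "\<epsilon> < \<bar>Agr (?X t) i j\<bar>"
    using act unfolding first_activity_across_def by (elim exE conjE)
  have cfg: "is_config n (?X s)" for s by (rule is_config_traj[OF f U \<omega>])
  \<comment> \<open>The weak bound \<open>\<epsilon>\<close> inside groups already suffices for
    \<open>rooted_by_merge\<close>, so this applies at the active time \<open>t\<close> as
    well.\<close>
  have apart_if: "\<bar>Agr (?X s) a b\<bar> \<le> \<eta>"
    if s: "\<And>k l. k < n \<Longrightarrow> l < n \<Longrightarrow> \<rho> k = \<rho> l \<Longrightarrow> \<epsilon> < \<bar>Agr (?X s) k l\<bar>"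
      and ab: "a < n" "b < n" "\<rho> a \<noteq> \<rho> b" for s a b
  proof (rule ccontr)
    assume "\<not> \<bar>Agr (?X s) a b\<bar> \<le> \<eta>"
    then have ab_gt: "\<eta> < \<bar>Agr (?X s) a b\<bar>" by simp
    have near: "\<eta> < \<bar>Agr (?X s) x (\<rho> x)\<bar>" if "x < n" for x
    proof -
      have "\<rho> x < n" using \<rho>(2)[OF that] R(1) by blast
      from s[OF that this \<rho>(1)[OF \<rho>(2)[OF that], symmetric]] show ?thesis using \<eta> by linarith
    qed
    have "rooted_by \<eta> n k (?X s)"
      by (rule rooted_by_merge[where \<rho> = \<rho>, OF R \<rho> near ab ab_gt])
    then show False using no by iprover
  qed
  have step: "\<epsilon> < \<bar>Agr (?X (Suc s)) x y\<bar>"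
    if s: "\<And>k l. k < n \<Longrightarrow> l < n \<Longrightarrow> \<rho> k = \<rho> l \<Longrightarrow> 1 - \<epsilon> \<le> \<bar>Agr (?X s) k l\<bar>"
      "\<And>k l. k < n \<Longrightarrow> l < n \<Longrightarrow> \<rho> k \<noteq> \<rho> l \<Longrightarrow> \<bar>Agr (?X s) k l\<bar> \<le> \<eta>"
      and xy: "x < n" "y < n" "\<rho> x = \<rho> y" for s x y
  proof -
    obtain a b where ab: "\<omega> s = (a, b)" "a < n" "b < n" "a \<noteq> b" using \<omega>[of s] by (auto simp: Omega_def)
    have "\<epsilon> < \<bar>Agr (update f (a, b) (?X s)) x y\<bar>"
      by (rule cluster_persists_step[where \<rho> = \<rho>, OF f cfg ab(2-4) \<epsilon> small s xy])
    then show ?thesis by (simp add: ab(1))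
  qed
  have inv: "(\<forall>k<n. \<forall>l<n. (\<rho> k = \<rho> l \<longrightarrow> 1 - \<epsilon> \<le> \<bar>Agr (?X s) k l\<bar>) \<and>
      (\<rho> k \<noteq> \<rho> l \<longrightarrow> \<bar>Agr (?X s) k l\<bar> \<le> \<eta>))" if "s < t" for s
    using that
  proof (induction s)
    case 0
    show ?case using tight apart by (intro allI impI conjI) simp_all
  next
    case (Suc s)
    have gt: "\<epsilon> < \<bar>Agr (?X (Suc s)) k l\<bar>" if "k < n" "l < n" "\<rho> k = \<rho> l" for k l
      using Suc.IH[OF Suc_lessD[OF Suc.prems]] by (intro step[OF _ _ that]) iprover+
    have "1 - \<epsilon> \<le> \<bar>Agr (?X (Suc s)) k l\<bar>" if "k < n" "l < n" "\<rho> k = \<rho> l" for k l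
    proof -
      \<comment> \<open>Inactivity before \<open>t\<close> upgrades the bound
        \<open>\<epsilon>\<close> to \<open>1 - \<epsilon>\<close>, which closes the
        induction.\<close>
      have "\<bar>Agr (?X (Suc s)) k l\<bar> \<le> \<epsilon> \<or> 1 - \<epsilon> \<le> \<bar>Agr (?X (Suc s)) k l\<bar>"
        using t(2)[rule_format, OF Suc.prems] that unfolding eps_inactive_iff by iprover
      then show ?thesis using gt[OF that] by linarith
    qed
    then show ?case by (intro allI impI conjI apart_if[OF gt])
  qed
  \<comment> \<open>The start is inactive, so \<open>t - 1\<close> really is the preceding
    time.\<close>
  have "t \<noteq> 0"
  proof
    assume "t = 0"
    have "\<bar>Agr U k l\<bar> \<le> \<epsilon> \<or> 1 - \<epsilon> \<le> \<bar>Agr U k l\<bar>" if "k < n" "l < n" for k l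
      using tight[OF that] apart[OF that] \<eta> by linarith
    then have "\<not> eps_active \<epsilon> n U" by (simp add: eps_inactive_iff)
    then show False using t(1) \<open>t = 0\<close> by simp
  qed
  then obtain s where s: "t = Suc s" by (cases t) auto
  have inv_s: "\<And>k l. k < n \<Longrightarrow> l < n \<Longrightarrow> \<rho> k = \<rho> l \<Longrightarrow> 1 - \<epsilon> \<le> \<bar>Agr (?X s) k l\<bar>"
    "\<And>k l. k < n \<Longrightarrow> l < n \<Longrightarrow> \<rho> k \<noteq> \<rho> l \<Longrightarrow> \<bar>Agr (?X s) k l\<bar> \<le> \<eta>"
    using inv[of s, unfolded s, OF lessI] by iprover+
  have "\<rho> i = \<rho> j"
  proof (rule ccontr)
    assume "\<rho> i \<noteq> \<rho> j"
    then have "\<bar>Agr (?X t) i j\<bar> \<le> \<eta>"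
      unfolding s by (intro apart_if[OF step[OF inv_s] ij(1,2)])
    then show False using ij(4) \<eta> by linarith
  qed
  have "diff_clusters \<epsilon> n (?X s) i j" using ij(3) by (simp add: s)
  then obtain C C' where "C \<in> clusters \<epsilon> n (?X s)" "C' \<in> clusters \<epsilon> n (?X s)"
    and CC': "C \<noteq> C'" "i \<in> C" "j \<in> C'" unfolding diff_clusters_def by (elim bexE conjE)
  then have C: "is_cluster \<epsilon> n (?X s) C" "is_cluster \<epsilon> n (?X s) C'" by (simp_all add: clusters_def)
  \<comment> \<open>As \<open>\<eta> \<le> \<epsilon> < 1 / 2\<close>, no agreement counts both as
    tight and as apart, so a cluster is determined by any of its members.\<close>
  have cluster_eq: "B = {x. x < n \<and> \<rho> x = \<rho> m}" if B: "is_cluster \<epsilon> n (?X s) B" "m \<in> B" for B m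
  proof (rule set_eqI)
    fix x
    have m: "m < n" using B by (auto simp: is_cluster_def)
    show "x \<in> B \<longleftrightarrow> x \<in> {x. x < n \<and> \<rho> x = \<rho> m}"
    proof
      assume "x \<in> B"
      then have x: "x < n" "1 - \<epsilon> \<le> \<bar>Agr (?X s) x m\<bar>" using B by (auto simp: is_cluster_def)
      moreover have "\<rho> x = \<rho> m" using inv_s(2)[OF x(1) m] x(2) \<epsilon> \<eta> by linarith
      ultimately show "x \<in> {x. x < n \<and> \<rho> x = \<rho> m}" by simp
    next
      assume "x \<in> {x. x < n \<and> \<rho> x = \<rho> m}"
      then have x: "x < n" "\<rho> m = \<rho> x" by simp_all
      then have "\<not> \<bar>Agr (?X s) m x\<bar> \<le> \<epsilon>" using inv_s(1)[OF m x] \<epsilon> by linarith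
      moreover have "\<forall>y\<in>{..<n} - B. \<bar>Agr (?X s) m y\<bar> \<le> \<epsilon>" using B by (simp add: is_cluster_def)
      ultimately show "x \<in> B" using x(1) by auto
    qed
  qed
  have "C = C'"
    unfolding cluster_eq[OF C(1) CC'(2)] cluster_eq[OF C(2) CC'(3)] \<open>\<rho> i = \<rho> j\<close> by (rule refl)
  then show False using CC'(1) by simp
qed

section \<open>Configurations in a narrow double cone\<close>

definition aligned :: "real \<Rightarrow> nat \<Rightarrow> 'd::finite config \<Rightarrow> bool" where
  "aligned \<delta> n U \<longleftrightarrow> (\<forall>i<n. \<forall>j<n. 1 - \<delta> \<le> \<bar>Agr U i j\<bar>)"

text \<open>The signs of the agreements with agent 0 work: \<open>inner_triangle_pos\<close> makes
  the sign of each agreement the product of the two signs relative to agent 0.\<close>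

lemma aligned_signs:
  assumes U: "is_config n U" and a: "aligned \<delta> n U" and \<delta>: "\<delta> < 1 / 2"
  shows "\<exists>\<sigma>. (\<forall>i<n. \<bar>\<sigma> i\<bar> = (1 :: real)) \<and> (\<forall>i<n. \<forall>j<n. 1 - \<delta> \<le> \<sigma> i * \<sigma> j * Agr U i j)"
proof (intro exI[of _ "\<lambda>i. sgn (Agr U 0 i)"] conjI allI impI)
  fix i assume i: "i < n"
  then have 0: "0 < n" by simp
  have big: "1 / 2 < \<bar>Agr U k l\<bar>" if "k < n" "l < n" for k l
    using a \<delta> that unfolding aligned_def by force
  show "\<bar>sgn (Agr U 0 i)\<bar> = 1" using big[OF 0 i] by (auto simp: sgn_if)
  fix j assume j: "j < n"
  have "0 < Agr U i 0 * Agr U 0 j * Agr U i j"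
    unfolding Agr_def using U 0 i j big[OF i 0] big[OF 0 j] big[OF i j]
    by (intro inner_triangle_pos) (auto simp: is_config_def Agr_def)
  then have "sgn (Agr U 0 i * Agr U 0 j * Agr U i j) = 1" by (simp add: Agr_commute[of U i 0])
  then have "sgn (Agr U 0 i) * sgn (Agr U 0 j) * sgn (Agr U i j) = 1" by (simp add: sgn_mult)
  then have "sgn (Agr U 0 i) * sgn (Agr U 0 j) = sgn (Agr U i j)"
    by (auto simp: sgn_if split: if_splits)
  then have "sgn (Agr U 0 i) * sgn (Agr U 0 j) * Agr U i j = \<bar>Agr U i j\<bar>" by (simp add: abs_sgn mult.commute)
  then show "1 - \<delta> \<le> sgn (Agr U 0 i) * sgn (Agr U 0 j) * Agr U i j" using a i j by (simp add: aligned_def)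
qed

text \<open>In terms of the sign-corrected vectors, the step adds a nonnegative multiple of that of
  \<open>j\<close> to that of \<open>i\<close> and divides by at most the sum of the weights. A
  nonnegative lower bound on inner products with any fixed \<open>y\<close> survives this.\<close>

lemma cone_step:
  assumes f: "stable_fun f" and V: "is_config n V" and ij: "i < n" "j < n" "i \<noteq> j"
    and \<sigma>: "\<And>k. k < n \<Longrightarrow> \<bar>\<sigma> k\<bar> = (1 :: real)" and pos: "0 < \<sigma> i * \<sigma> j * Agr V i j"
    and y: "\<And>k. k < n \<Longrightarrow> c \<le> \<sigma> k * (V k \<bullet> y)" and c: "0 \<le> c" and k: "k < n"
  shows "c \<le> \<sigma> k * (update f (i, j) V k \<bullet> y)"
proof (cases "k = i")
  case True
  let ?N = "pre_norm f V i j" and ?A = "Agr V i j"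
  have N: "1 \<le> ?N" "?N \<le> 1 + \<bar>f ?A\<bar>" by (rule pre_norm_ge_1[OF f V ij(1,2)] pre_norm_le[OF V ij(1,2)])+
  have s: "\<sigma> i = 1 \<or> \<sigma> i = -1" "\<sigma> j = 1 \<or> \<sigma> j = -1" using \<sigma>[OF ij(1)] \<sigma>[OF ij(2)] by linarith+
  have "sgn (f ?A) = sgn ?A" by (rule stable_fun_sgn[OF f Agr_bound[OF V ij(1,2)]])
  moreover have "sgn ?A = \<sigma> i * \<sigma> j" using s pos by (auto simp: sgn_if)
  ultimately have "f ?A = \<bar>f ?A\<bar> * (\<sigma> i * \<sigma> j)" by (metis abs_mult_sgn)
  then have sf: "\<sigma> i * f ?A = \<bar>f ?A\<bar> * \<sigma> j" using s
    by (elim disjE) simp_all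
  have "c * ?N \<le> c * (1 + \<bar>f ?A\<bar>)" using N c by (intro mult_left_mono)
  also have "\<dots> = c + \<bar>f ?A\<bar> * c" by (simp add: algebra_simps)
  also have "\<dots> \<le> \<sigma> i * (V i \<bullet> y) + \<bar>f ?A\<bar> * (\<sigma> j * (V j \<bullet> y))"
    using y ij by (intro add_mono mult_left_mono) auto
  also have "\<dots> = \<sigma> i * (V i \<bullet> y + f ?A * (V j \<bullet> y))"
    by (simp add: distrib_left flip: mult.assoc) (simp add: sf)
  finally have "c \<le> \<sigma> i * (V i \<bullet> y + f ?A * (V j \<bullet> y)) / ?N"
    using less_le_trans[OF zero_less_one N(1)] by (simp only: pos_le_divide_eq)
  then show ?thesis by (simp add: True update_inner)
next
  case False
  then show ?thesis using y[OF k] by (simp only: update_other[OF False])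
qed

text \<open>Only \<open>i\<close> moves, so \<open>cone_step\<close> with \<open>y\<close> the
  sign-corrected vector of the other agent handles every pair except \<open>i\<close> with itself,
  whose agreement is 1.\<close>

lemma cone_step_Agr:
  assumes f: "stable_fun f" and V: "is_config n V" and ij: "i < n" "j < n" "i \<noteq> j"
    and \<sigma>: "\<And>k. k < n \<Longrightarrow> \<bar>\<sigma> k\<bar> = (1 :: real)"
    and a: "\<And>k l. k < n \<Longrightarrow> l < n \<Longrightarrow> c \<le> \<sigma> k * \<sigma> l * Agr V k l" and c: "0 < c"
    and kl: "k < n" "l < n"
  shows "c \<le> \<sigma> k * \<sigma> l * Agr (update f (i, j) V) k l"
proof -
  let ?W = "update f (i, j) V"
  have pos: "0 < \<sigma> i * \<sigma> j * Agr V i j" using a[OF ij(1,2)] c by linarith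
  have s1: "\<sigma> x * \<sigma> x = 1" if "x < n" for x using \<sigma>[OF that] by (metis abs_mult_self_eq mult_1)
  have main: "c \<le> \<sigma> x * \<sigma> m * (?W x \<bullet> V m)" if "x < n" "m < n" for x m
    using cone_step[OF f V ij \<sigma> pos _ less_imp_le[OF c] that(1), of "\<sigma> m *\<^sub>R V m"] a that
    by (simp add: Agr_def mult.assoc)
  consider "k \<noteq> i" | "l \<noteq> i" | "k = i" "l = i" by blast
  then show ?thesis
  proof cases
    case 1
    then show ?thesis using main[OF kl(2,1)] by (simp add: Agr_def update_other inner_commute mult.commute mult.left_commute)
  next
    case 2
    then show ?thesis using main[OF kl] by (simp add: Agr_def update_other)
  next
    case 3
    have "c \<le> 1" using a[OF ij(1,1)] s1[OF ij(1)] Agr_self[OF V ij(1)] by simp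
    then show ?thesis
      using 3 s1[OF ij(1)] Agr_self[OF is_config_update[OF f V ij(1,2)] ij(1)] by simp
  qed
qed

text \<open>Two bounds are carried together: current agreements keep the sign pattern usable for the
  next step, and inner products with the opinions frozen at time \<open>s\<close> show that no agent
  drifts away from them.\<close>

lemma cone_traj:
  assumes f: "stable_fun f" and U: "is_config n U" and \<omega>: "\<And>t. \<omega> t \<in> Omega n"
    and \<sigma>: "\<And>k. k < n \<Longrightarrow> \<bar>\<sigma> k\<bar> = (1 :: real)"
    and a: "\<And>k l. k < n \<Longrightarrow> l < n \<Longrightarrow> c \<le> \<sigma> k * \<sigma> l * Agr (traj f U \<omega> s) k l" and c: "0 < c"
    and st: "s \<le> t"
  shows "\<forall>k<n. \<forall>l<n. c \<le> \<sigma> k * \<sigma> l * Agr (traj f U \<omega> t) k l \<and>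
    c \<le> \<sigma> k * \<sigma> l * (traj f U \<omega> t k \<bullet> traj f U \<omega> s l)"
  using st
proof (induction t rule: dec_induct)
  case base
  then show ?case using a by (simp add: Agr_def)
next
  case (step t)
  let ?V = "traj f U \<omega> t"
  have V: "is_config n ?V" by (rule is_config_traj[OF f U \<omega>])
  obtain i j where ij: "\<omega> t = (i, j)" "i < n" "j < n" "i \<noteq> j" using \<omega>[of t] by (auto simp: Omega_def)
  have A: "c \<le> \<sigma> k * \<sigma> l * Agr ?V k l" if "k < n" "l < n" for k l using step that by simp
  have pos: "0 < \<sigma> i * \<sigma> j * Agr ?V i j" using A[OF ij(2,3)] c by linarith
  have "c \<le> \<sigma> k * \<sigma> l * (update f (i, j) ?V k \<bullet> traj f U \<omega> s l)" if "k < n" "l < n" for k l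
    using cone_step[OF f V ij(2-4) \<sigma> pos _ less_imp_le[OF c] that(1), of "\<sigma> l *\<^sub>R traj f U \<omega> s l"] step that
    by (simp add: mult.assoc)
  then show ?case using cone_step_Agr[OF f V ij(2-4) \<sigma> A c] by (simp add: ij(1))
qed

lemma polarizes_if_aligned:
  fixes U :: "'d::finite config"
  assumes f: "stable_fun f" and U: "is_config n U" and \<omega>: "\<And>t. \<omega> t \<in> Omega n" and n: "0 < n"
    and al: "\<And>\<delta>. 0 < \<delta> \<Longrightarrow> \<exists>t. aligned \<delta> n (traj f U \<omega> t)"
  shows "polarizes n (traj f U \<omega>)"
proof -
  let ?X = "traj f U \<omega>"
  have cfg: "is_config n (?X s)" for s by (rule is_config_traj[OF f U \<omega>])
  have persist: "aligned \<delta> n (?X t)" if s: "aligned \<delta> n (?X s)" and st: "s \<le> t" and \<delta>: "\<delta> < 1 / 2" for \<delta> s t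
  proof -
    obtain \<sigma> where \<sigma>: "\<forall>i<n. \<bar>\<sigma> i\<bar> = (1 :: real)" "\<forall>i<n. \<forall>j<n. 1 - \<delta> \<le> \<sigma> i * \<sigma> j * Agr (?X s) i j"
      using aligned_signs[OF cfg s \<delta>] by blast
    have "1 - \<delta> \<le> \<bar>Agr (?X t) k l\<bar>" if kl: "k < n" "l < n" for k l
    proof -
      have "1 - \<delta> \<le> \<sigma> k * \<sigma> l * Agr (?X t) k l"
        using cone_traj[where \<omega> = \<omega> and s = s and t = t and \<sigma> = \<sigma> and c = "1 - \<delta>", OF f U \<omega>] \<sigma> \<delta> st kl by simp
      also have "\<dots> \<le> \<bar>\<sigma> k * \<sigma> l * Agr (?X t) k l\<bar>" by simp
      also have "\<dots> = \<bar>Agr (?X t) k l\<bar>" using \<sigma>(1) kl by (simp add: abs_mult)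
      finally show ?thesis .
    qed
    then show ?thesis by (simp add: aligned_def)
  qed
  \<comment> \<open>The signs are fixed once, at this coarse alignment. By \<open>pos\<close> below,
    every later and finer alignment has the same sign pattern.\<close>
  obtain t0 where t0: "aligned (1 / 4) n (?X t0)" using al[of "1 / 4"] by auto
  obtain \<sigma> where \<sigma>: "\<And>i. i < n \<Longrightarrow> \<bar>\<sigma> i\<bar> = (1 :: real)"
    and pos0: "\<forall>i<n. \<forall>j<n. 1 - 1 / 4 \<le> \<sigma> i * \<sigma> j * Agr (?X t0) i j"
    using aligned_signs[OF cfg t0] by auto
  have pos: "0 < \<sigma> k * \<sigma> l * Agr (?X t) k l" if "t0 \<le> t" "k < n" "l < n" for t k l
    using cone_traj[where \<omega> = \<omega> and \<sigma> = \<sigma> and s = t0 and t = t and c = "1 - 1 / 4", OF f U \<omega> \<sigma>] pos0 that by fastforce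
  define v where "v k t = \<sigma> k *\<^sub>R ?X t k" for k t
  have norm_v: "norm (v k t) = 1" if "k < n" for k t
    using cfg[of t] \<sigma>[OF that] that by (simp add: v_def is_config_def)
  have close: "\<exists>T. \<forall>t\<ge>T. \<forall>k<n. dist (v k t) (v 0 T) < e" if e: "0 < e" for e
  proof -
    \<comment> \<open>Unit vectors with inner product at least \<open>1 - \<delta>\<close> have
      squared distance at most \<open>2 * \<delta>\<close>; the cap 1/4 keeps \<open>persist\<close>
      applicable.\<close>
    define \<delta> where "\<delta> = min (1 / 4) (e\<^sup>2 / 4)"
    have \<delta>: "0 < \<delta>" "\<delta> < 1 / 2" "2 * \<delta> < e\<^sup>2" using e by (auto simp: \<delta>_def min_def)
    obtain t1 where t1: "aligned \<delta> n (?X t1)" using al[OF \<delta>(1)] by blast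
    define T where "T = max t0 t1"
    have T: "aligned \<delta> n (?X T)" using persist[OF t1 _ \<delta>(2)] by (simp add: T_def)
    have "1 - \<delta> \<le> \<sigma> k * \<sigma> l * Agr (?X T) k l" if kl: "k < n" "l < n" for k l
    proof -
      have "\<sigma> k * \<sigma> l * Agr (?X T) k l = \<bar>\<sigma> k * \<sigma> l * Agr (?X T) k l\<bar>"
        using pos[of T k l] kl by (simp add: T_def)
      also have "\<dots> = \<bar>Agr (?X T) k l\<bar>" using \<sigma> kl by (simp add: abs_mult)
      finally show ?thesis using T kl by (simp add: aligned_def)
    qed
    then have c: "1 - \<delta> \<le> \<sigma> k * \<sigma> 0 * (?X t k \<bullet> ?X T 0)" if "T \<le> t" "k < n" for t k
      using cone_traj[where \<omega> = \<omega> and \<sigma> = \<sigma> and s = T and t = t and c = "1 - \<delta>", OF f U \<omega> \<sigma>] \<delta>(2) that n by simp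
    have "dist (v k t) (v 0 T) < e" if "T \<le> t" "k < n" for t k
    proof -
      have "(dist (v k t) (v 0 T))\<^sup>2 = (norm (v k t))\<^sup>2 + (norm (v 0 T))\<^sup>2 - 2 * (v k t \<bullet> v 0 T)"
        by (simp add: dist_norm power2_norm_eq_inner inner_diff_left inner_diff_right inner_commute)
      also have "\<dots> = 2 - 2 * (\<sigma> k * \<sigma> 0 * (?X t k \<bullet> ?X T 0))"
        using norm_v that(2) n by (simp add: v_def)
      also have "\<dots> < e\<^sup>2" using c[OF that] \<delta>(3) by linarith
      finally show ?thesis using e by (simp add: power2_less_imp_less)
    qed
    then show ?thesis by blast
  qed
  have "Cauchy (v 0)"
  proof (rule metric_CauchyI)
    fix e :: real assume "0 < e"
    then obtain T where T: "\<forall>t\<ge>T. \<forall>k<n. dist (v k t) (v 0 T) < e / 2" using close[of "e / 2"] by auto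
    have "dist (v 0 s) (v 0 t) < e" if "T \<le> s" "T \<le> t" for s t
    proof (rule dist_triangle_half_l)
      show "dist (v 0 s) (v 0 T) < e / 2" "dist (v 0 t) (v 0 T) < e / 2" using T n that by blast+
    qed
    then show "\<exists>M. \<forall>s\<ge>M. \<forall>t\<ge>M. dist (v 0 s) (v 0 t) < e" by blast
  qed
  then obtain y where y: "v 0 \<longlonglongrightarrow> y" using Cauchy_convergent convergent_def by blast
  have lim: "v k \<longlonglongrightarrow> y" if k: "k < n" for k
  proof -
    have "(\<lambda>t. v k t - v 0 t) \<longlonglongrightarrow> 0"
    proof (rule LIMSEQ_I)
      fix e :: real assume "0 < e"
      then obtain T where T: "\<forall>t\<ge>T. \<forall>k<n. dist (v k t) (v 0 T) < e / 2" using close[of "e / 2"] by auto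
      have "dist (v k t) (v 0 t) < e" if "T \<le> t" for t
      proof (rule dist_triangle_half_l)
        show "dist (v k t) (v 0 T) < e / 2" "dist (v 0 t) (v 0 T) < e / 2" using T n k that by blast+
      qed
      then show "\<exists>T. \<forall>t\<ge>T. norm (v k t - v 0 t - 0) < e" by (auto simp: dist_norm)
    qed
    from tendsto_add[OF this y] show ?thesis by simp
  qed
  have lim_X: "(\<lambda>t. ?X t k) \<longlonglongrightarrow> \<sigma> k *\<^sub>R y" if k: "k < n" for k
  proof -
    have "\<sigma> k * \<sigma> k = 1" using \<sigma>[OF k] by (metis abs_mult_self_eq mult_1)
    then have "?X t k = \<sigma> k *\<^sub>R v k t" for t by (simp add: v_def)
    then show ?thesis using tendsto_scaleR[OF tendsto_const lim[OF k]] by simp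
  qed
  have "polarized n (\<lambda>k. \<sigma> k *\<^sub>R y)"
    unfolding polarized_def
  proof (intro allI impI)
    fix i j assume "i < n" "j < n"
    then have "\<sigma> i = 1 \<or> \<sigma> i = -1" "\<sigma> j = 1 \<or> \<sigma> j = -1" using \<sigma>[of i] \<sigma>[of j] by linarith+
    then show "\<sigma> i *\<^sub>R y = \<sigma> j *\<^sub>R y \<or> \<sigma> i *\<^sub>R y = - (\<sigma> j *\<^sub>R y)" by auto
  qed
  then show ?thesis
    unfolding polarizes_def using lim_X by (intro exI[of _ "\<lambda>k. \<sigma> k *\<^sub>R y"] conjI allI impI)
qed

section \<open>Reaching alignment\<close>

text \<open>For \<open>\<epsilon> \<ge> 1/2\<close> no configuration is active, while agreements equal to 1/2 create two clusters.\<close>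

lemma dn_stable_eps_less_half:
  assumes d: "CARD('d::finite) \<ge> 2" and n: "n \<ge> 2"
    and stab: "\<And>U :: 'd config. is_config n U \<Longrightarrow> \<not> eps_active \<epsilon> n U \<Longrightarrow> \<not> separable n U
          \<Longrightarrow> card (clusters \<epsilon> n U) \<ge> 2 \<Longrightarrow> (AE \<omega> in interactions D. \<exists>t. eps_active \<epsilon> n (traj f U \<omega> t))"
  shows "\<epsilon> < 1 / 2"
proof (rule ccontr)
  assume \<epsilon>: "\<not> \<epsilon> < 1 / 2"
  have inactive: "\<not> eps_active \<epsilon> n U" for U :: "'d config" using \<epsilon> by (auto simp: eps_active_def)
  have "\<exists>a b :: 'd. a \<noteq> b"
  proof (rule ccontr)
    assume "\<nexists>a b :: 'd. a \<noteq> b"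
    then have "card (UNIV :: 'd set) \<le> Suc 0" by (subst card_le_Suc0_iff_eq) auto
    then show False using d by simp
  qed
  then obtain a b :: 'd where ab: "a \<noteq> b" by blast
  \<comment> \<open>Two unit vectors at 60 degrees, so that their agreement is exactly 1/2; this
    takes two coordinates.\<close>
  define u v :: "real ^ 'd" where "u = axis a 1" and "v = (1 / 2) *\<^sub>R axis a 1 + (sqrt 3 / 2) *\<^sub>R axis b 1"
  define U :: "'d config" where "U i = (if i = 0 then v else u)" for i
  have i: "u \<bullet> u = 1" "u \<bullet> v = 1 / 2" "v \<bullet> u = 1 / 2" "v \<bullet> v = 1"
    using ab by (simp_all add: u_def v_def inner_add_left inner_add_right inner_axis_axis)
  have Agr: "Agr U k l = (if (k = 0) = (l = 0) then 1 else 1 / 2)" for k l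
    by (simp add: Agr_def U_def i)
  have "is_config n U" by (simp add: is_config_def U_def norm_eq_1 i)
  moreover have "\<not> separable n U"
    unfolding separable_def by (auto simp: Agr)
  moreover have "card (clusters \<epsilon> n U) \<ge> 2"
  proof -
    \<comment> \<open>Because \<open>1 - \<epsilon> \<le> 1 / 2 \<le> \<epsilon>\<close>, an
      agreement of 1/2 is allowed both inside a cluster and across its boundary.\<close>
    have "{{0}, {..<n}} \<subseteq> clusters \<epsilon> n U"
      using n \<epsilon> by (auto simp: clusters_def is_cluster_def Agr lessThan_empty_iff bot_nat_def)
    moreover have "finite (clusters \<epsilon> n U)"
      by (rule finite_subset[of _ "Pow {..<n}"]) (auto simp: clusters_def is_cluster_def)
    ultimately have "card {{0}, {..<n}} \<le> card (clusters \<epsilon> n U)" by (intro card_mono)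
    moreover have "{0} \<noteq> {..<n}"
    proof
      assume "{0} = {..<n}"
      moreover have "1 \<in> {..<n}" using n by simp
      ultimately show False by (metis singletonD zero_neq_one)
    qed
    ultimately show ?thesis by simp
  qed
  ultimately have "AE \<omega> in interactions D. False" using stab[of U] inactive by simp
  then show False using prob_space.AE_False[OF prob_space_interactions, of D] by simp
qed

text \<open>Induction on the component bound. After the collapsing word either fewer components
  suffice, or there is a single group and alignment is reached, or the stability hypothesis yields a
  drop with probability at least \<open>p\<close>. The lower bounds multiply along the induction and
  never depend on \<open>U\<close>.\<close>

lemma hit_aligned:
  assumes n: "0 < n" and D: "set_pmf D = Omega n" and f: "stable_fun f"
    and \<epsilon>: "0 < \<epsilon>" "\<epsilon> < 1 / 2" and \<eta>: "0 < \<eta>" "\<eta> \<le> \<epsilon>"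
    and small: "\<And>A. \<bar>A\<bar> \<le> \<eta> \<Longrightarrow> \<bar>f A\<bar> \<le> (1 - 2 * \<epsilon>) / 4"
    and p: "0 < p" and \<delta>: "0 < \<delta>"
    and stab: "\<And>U :: 'd::finite config. is_config n U \<Longrightarrow> \<not> eps_active \<epsilon> n U \<Longrightarrow> \<not> separable n U
      \<Longrightarrow> card (clusters \<epsilon> n U) \<ge> 2
      \<Longrightarrow> p \<le> measure (interactions D) {\<omega>. first_activity_across \<epsilon> n (traj f U \<omega>)}"
  shows "\<exists>q>0. \<forall>U :: 'd config. is_config n U \<longrightarrow> \<not> separable n U \<longrightarrow> rooted_by \<eta> n k U \<longrightarrow>
    q \<le> hit f D (aligned \<delta> n) U"
proof (induction k)
  case 0
  show ?case by (intro exI[of _ 1]) (simp add: not_rooted_by_0[OF n])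
next
  case (Suc k)
  interpret S: prob_space "interactions D" by (rule prob_space_interactions)
  have fin: "finite (set_pmf D)"
    unfolding D by (rule finite_subset[of _ "{..<n} \<times> {..<n}"]) (auto simp: Omega_def)
  obtain q where q: "0 < q" "\<And>U :: 'd config. is_config n U \<Longrightarrow> \<not> separable n U \<Longrightarrow> rooted_by \<eta> n k U \<Longrightarrow>
    q \<le> hit f D (aligned \<delta> n) U" using Suc by blast
  \<comment> \<open>Two agents gathered at the same root agree up to \<open>4 * \<delta>'\<close>,
    whence the quarters of \<open>\<delta>\<close> and \<open>\<epsilon>\<close>; the last term is
    what \<open>collapse\<close> requires.\<close>
  define \<delta>' where "\<delta>' = min (min (\<delta> / 4) (\<epsilon> / 4)) (\<eta>\<^sup>2 / 8)"
  have \<delta>': "0 < \<delta>'" "8 * \<delta>' \<le> \<eta>\<^sup>2" "4 * \<delta>' \<le> \<delta>" "4 * \<delta>' \<le> \<epsilon>"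
    using \<delta> \<epsilon> \<eta> by (auto simp: \<delta>'_def min_def)
  have "\<eta> \<le> 1" using \<epsilon> \<eta> by linarith
  from collapse[OF f \<eta>(1) this \<delta>'(1,2), of n "Suc k"] obtain L where L:
    "\<And>U :: 'd config. is_config n U \<Longrightarrow> rooted_by \<eta> n (Suc k) U \<Longrightarrow>
    (\<exists>w R \<rho>. set w \<subseteq> Omega n \<and> length w \<le> L \<and> R \<subseteq> {..<n} \<and> card R \<le> Suc k \<and> (\<forall>r\<in>R. \<rho> r = r) \<and>
      (\<forall>i<n. \<rho> i \<in> R \<and> 1 - \<delta>' \<le> \<bar>Agr (fold (update f) w U) i (\<rho> i)\<bar>))" by blast
  obtain c where c: "0 < c" "\<And>w (U :: 'd config) G. set w \<subseteq> set_pmf D \<Longrightarrow> length w \<le> L \<Longrightarrow>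
    c * hit f D G (fold (update f) w U) \<le> hit f D G U"
    using hit_after_bounded_word[OF fin, of L f, where ?'d = 'd] by blast
  \<comment> \<open>One entry for each outcome after the word: already aligned, already fewer
    components, or a drop still to come.\<close>
  define q' where "q' = min 1 (min q (q * p))"
  have "c * q' \<le> hit f D (aligned \<delta> n) U"
    if U: "is_config n U" "\<not> separable n U" "rooted_by \<eta> n (Suc k) U" for U :: "'d config"
  proof -
    obtain w R \<rho> where w: "set w \<subseteq> Omega n" "length w \<le> L" and R: "R \<subseteq> {..<n}" "card R \<le> Suc k"
      and \<rho>': "\<forall>r\<in>R. \<rho> r = r" "\<forall>i<n. \<rho> i \<in> R \<and> 1 - \<delta>' \<le> \<bar>Agr (fold (update f) w U) i (\<rho> i)\<bar>"
      using L[OF U(1,3)] by blast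
    define V where "V = fold (update f) w U"
    have V: "is_config n V" "\<not> separable n V"
      using nonseparable_config_fold[OF f w(1), of U] U by (simp_all add: V_def)
    have \<rho>: "\<And>r. r \<in> R \<Longrightarrow> \<rho> r = r" "\<And>i. i < n \<Longrightarrow> \<rho> i \<in> R"
      and near: "\<And>i. i < n \<Longrightarrow> 1 - \<delta>' \<le> \<bar>Agr V i (\<rho> i)\<bar>" using \<rho>' by (auto simp: V_def)
    have same: "1 - 4 * \<delta>' \<le> \<bar>Agr V i j\<bar>" if ij: "i < n" "j < n" "\<rho> i = \<rho> j" for i j
    proof -
      have "\<rho> j < n" using \<rho>(2)[OF ij(2)] R(1) by auto
      then show ?thesis
        using abs_inner_common_neighbour[of "V i" "V (\<rho> j)" "V j" \<delta>'] near[OF ij(1)] near[OF ij(2)] V(1) ij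
        by (simp add: Agr_def is_config_def)
    qed
    have "q' \<le> hit f D (aligned \<delta> n) V"
    proof (cases "rooted_by \<eta> n k V")
      case True
      then show ?thesis using q(2)[OF V] by (simp add: q'_def)
    next
      case False
      have apart: "\<bar>Agr V i j\<bar> \<le> \<eta>" if ij: "i < n" "j < n" "\<rho> i \<noteq> \<rho> j" for i j
      proof (rule ccontr)
        assume "\<not> \<bar>Agr V i j\<bar> \<le> \<eta>"
        moreover have "\<eta> < \<bar>Agr V x (\<rho> x)\<bar>" if "x < n" for x
          using near[OF that] \<delta>' \<epsilon> \<eta> by linarith
        ultimately have "rooted_by \<eta> n k V"
          using ij by (intro rooted_by_merge[OF R, of \<rho> \<eta> V i j] \<rho>) auto
        then show False using False by simp
      qed
      have tight: "1 - \<epsilon> \<le> \<bar>Agr V i j\<bar>" if "i < n" "j < n" "\<rho> i = \<rho> j" for i j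
        using same[OF that] \<delta>' by linarith
      show ?thesis
      proof (cases "\<exists>i<n. \<exists>j<n. \<rho> i \<noteq> \<rho> j")
        case False
        have "1 - \<delta> \<le> \<bar>Agr V i j\<bar>" if ij: "i < n" "j < n" for i j
        proof -
          have "\<rho> i = \<rho> j" using False ij by blast
          then show ?thesis using same[OF ij] \<delta>'(3) by linarith
        qed
        then have "aligned \<delta> n V" by (simp add: aligned_def)
        then show ?thesis by (simp add: hit_now q'_def)
      next
        case True
        then obtain i j where ij: "i < n" "j < n" "\<rho> i \<noteq> \<rho> j" by blast
        have inactive: "\<not> eps_active \<epsilon> n V"
        proof -
          have "\<bar>Agr V k l\<bar> \<le> \<epsilon> \<or> 1 - \<epsilon> \<le> \<bar>Agr V k l\<bar>" if "k < n" "l < n" for k l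
            using tight[OF that] apart[OF that] \<eta> by linarith
          then show ?thesis by (simp add: eps_inactive_iff)
        qed
        have card: "2 \<le> card (clusters \<epsilon> n V)"
        proof -
          define B where "B m = {x. x < n \<and> \<rho> x = \<rho> m}" for m
          have "is_cluster \<epsilon> n V (B m)" if "m < n" for m
            unfolding is_cluster_def
          proof (intro conjI ballI)
            fix x y assume x: "x \<in> B m"
            show "1 - \<epsilon> \<le> \<bar>Agr V x y\<bar>" if "y \<in> B m" using x that by (intro tight) (auto simp: B_def)
            show "\<bar>Agr V x y\<bar> \<le> \<epsilon>" if "y \<in> {..<n} - B m"
              using apart[of x y] x that \<eta> by (auto simp: B_def)
          qed (use that in \<open>auto simp: B_def\<close>)
          then have "{B i, B j} \<subseteq> clusters \<epsilon> n V" using ij by (auto simp: clusters_def)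
          moreover have "finite (clusters \<epsilon> n V)"
            by (rule finite_subset[of _ "Pow {..<n}"]) (auto simp: clusters_def is_cluster_def)
          ultimately have "card {B i, B j} \<le> card (clusters \<epsilon> n V)" by (intro card_mono)
          moreover have "B i \<noteq> B j" using ij by (auto simp: B_def)
          ultimately show ?thesis by simp
        qed
        have "p \<le> measure (interactions D) {\<omega>. first_activity_across \<epsilon> n (traj f V \<omega>)}"
          by (rule stab[OF V(1) inactive V(2) card])
        also have "\<dots> \<le> hit f D (rooted_by \<eta> n k) V"
          unfolding hit_def
        proof (rule S.finite_measure_mono_AE[OF _ hit_sets])
          \<comment> \<open>The inclusion is proved for sequences of interactions in
            \<open>Omega n\<close>, hence almost surely.\<close>
          show "AE \<omega> in interactions D. \<omega> \<in> {\<omega>. first_activity_across \<epsilon> n (traj f V \<omega>)}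
              \<longrightarrow> \<omega> \<in> {\<omega>. \<exists>t. rooted_by \<eta> n k (traj f V \<omega> t)}"
            using AE_interactions_in_support
          proof eventually_elim
            fix \<omega> :: "nat \<Rightarrow> nat \<times> nat" assume \<omega>: "\<forall>t. \<omega> t \<in> set_pmf D"
            show "\<omega> \<in> {\<omega>. first_activity_across \<epsilon> n (traj f V \<omega>)}
              \<longrightarrow> \<omega> \<in> {\<omega>. \<exists>t. rooted_by \<eta> n k (traj f V \<omega> t)}"
            proof (intro impI CollectI, elim CollectE)
              assume "first_activity_across \<epsilon> n (traj f V \<omega>)"
              moreover have "\<omega> t \<in> Omega n" for t using \<omega> D by blast
              ultimately show "\<exists>t. rooted_by \<eta> n k (traj f V \<omega> t)"
                by (intro first_activity_merges[OF f V(1) _ \<epsilon> \<eta>(2) small R \<rho> tight apart])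
            qed
          qed
        qed
        finally have "q * p \<le> q * hit f D (rooted_by \<eta> n k) V" using q(1) by (intro mult_left_mono) auto
        also have "\<dots> \<le> hit f D (aligned \<delta> n) V"
        \<comment> \<open>Restart when the component count has dropped; the induction hypothesis
          gives \<open>q\<close> from there.\<close>
        proof (rule hit_trans[OF fin, where I = "\<lambda>V. is_config n V \<and> \<not> separable n V"])
          show "is_config n (update f x W) \<and> \<not> separable n (update f x W)"
            if "x \<in> set_pmf D" "is_config n W \<and> \<not> separable n W" for x and W :: "'d config"
            using nonseparable_config_update[OF f] that unfolding D by blast
        qed (use q V in auto)
        finally show ?thesis by (simp add: q'_def)
      qed
    qed
    then have "c * q' \<le> c * hit f D (aligned \<delta> n) V" using c(1) by (intro mult_left_mono) auto
    also have "\<dots> \<le> hit f D (aligned \<delta> n) U" using c(2)[of w] w unfolding D V_def by blast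
    finally show ?thesis .
  qed
  moreover have "0 < c * q'" using c(1) q(1) p by (simp add: q'_def)
  ultimately show ?case by blast
qed

theorem mainTheorem4:
  fixes f :: "real \<Rightarrow> real" and n :: nat and D :: "(nat \<times> nat) pmf"
    and U0 :: "'d::finite config"
  assumes "CARD('d) \<ge> 2" and "n \<ge> 2"
    and "set_pmf D = Omega n"
    and "dn_stable TYPE('d) n D f"
    and "is_config n U0"
    and "\<not> separable n U0"
  shows "AE \<omega> in interactions D. polarizes n (traj f U0 \<omega>)"
proof -
  note d = assms(1) and n = assms(2) and D = assms(3) and U0 = assms(5,6)
  have f: "stable_fun f" using assms(4) by (simp add: dn_stable_def)
  obtain \<epsilon> p where \<epsilon>: "0 < \<epsilon>" and p: "0 < p" and stab: "\<forall>U :: 'd config. is_config n U \<and> \<not> eps_active \<epsilon> n U \<and> \<not> separable n U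
          \<and> card (clusters \<epsilon> n U) \<ge> 2 \<longrightarrow>
        (AE \<omega> in interactions D. \<exists>t. eps_active \<epsilon> n (traj f U \<omega> t)) \<and>
        measure (interactions D) {\<omega>. first_activity_across \<epsilon> n (traj f U \<omega>)} \<ge> p"
    using assms(4) unfolding dn_stable_def first_activity_across_def space_interactions
    by (simp only: UNIV_I simp_thms) (elim conjE exE)
  \<comment> \<open>Persistence of clusters relies on the gap between \<open>\<epsilon>\<close> and
    \<open>1 - \<epsilon>\<close>.\<close>
  have half: "\<epsilon> < 1 / 2" by (rule dn_stable_eps_less_half[OF d n, where D = D and f = f]) (use stab in simp)
  have fin: "finite (set_pmf D)"
    unfolding D by (rule finite_subset[of _ "{..<n} \<times> {..<n}"]) (auto simp: Omega_def)
  have cont: "continuous_on {-1..1} f" using f by (simp add: stable_fun_def)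
  obtain \<eta>0 where \<eta>0: "0 < \<eta>0" "\<And>A. A \<in> {-1..1} \<Longrightarrow> dist A 0 < \<eta>0 \<Longrightarrow> dist (f A) (f 0) < (1 - 2 * \<epsilon>) / 4"
    using cont[unfolded continuous_on_iff, rule_format, of 0 "(1 - 2 * \<epsilon>) / 4"] half by auto
  \<comment> \<open>The half turns \<open>\<le>\<close> into the strict inequality of continuity at
    0, and the bound by \<open>\<epsilon>\<close> keeps the argument of \<open>f\<close> in
    \<open>{-1..1}\<close>.\<close>
  define \<eta> where "\<eta> = min \<epsilon> (\<eta>0 / 2)"
  have \<eta>: "0 < \<eta>" "\<eta> \<le> \<epsilon>" using \<epsilon> \<eta>0(1) by (auto simp: \<eta>_def)
  have small: "\<bar>f A\<bar> \<le> (1 - 2 * \<epsilon>) / 4" if "\<bar>A\<bar> \<le> \<eta>" for A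
  proof -
    have "A \<in> {-1..1}" "dist A 0 < \<eta>0" using that half \<eta>0(1) by (auto simp: \<eta>_def abs_le_iff)
    then show ?thesis using \<eta>0(2)[of A] by (simp add: stable_fun_zero[OF f])
  qed
  have hit1: "hit f D (aligned \<delta> n) U0 = 1" if \<delta>: "0 < \<delta>" for \<delta>
  proof -
    \<comment> \<open>With \<open>n\<close> roots allowed, \<open>rooted_by_all\<close> makes the
      component condition vacuous, so \<open>q\<close> serves every non-separable
      configuration.\<close>
    have "\<exists>q>0. \<forall>U :: 'd config. is_config n U \<longrightarrow> \<not> separable n U \<longrightarrow> rooted_by \<eta> n n U \<longrightarrow>
        q \<le> hit f D (aligned \<delta> n) U"
      using n stab by (intro hit_aligned[OF _ D f \<epsilon> half \<eta> small p \<delta>]) auto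
    then obtain q where q: "0 < q" "\<And>U :: 'd config. is_config n U \<Longrightarrow> \<not> separable n U \<Longrightarrow>
        q \<le> hit f D (aligned \<delta> n) U" using rooted_by_all by blast
    show ?thesis
    proof (rule hit_eq_1[OF fin, where I = "\<lambda>V. is_config n V \<and> \<not> separable n V" and q = q])
      show "is_config n (update f x W) \<and> \<not> separable n (update f x W)"
        if "x \<in> set_pmf D" "is_config n W \<and> \<not> separable n W" for x and W :: "'d config"
        using nonseparable_config_update[OF f] that unfolding D by blast
    qed (use q U0 in auto)
  qed
  \<comment> \<open>Countably many widths suffice, so the exceptional null sets can be
    united.\<close>
  have "AE \<omega> in interactions D. \<forall>m::nat. \<exists>t. aligned (1 / (real m + 1)) n (traj f U0 \<omega> t)"
    unfolding AE_all_countable by (intro allI hit_1_AE hit1) simp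
  moreover have "AE \<omega> in interactions D. \<forall>t. \<omega> t \<in> Omega n"
    using AE_interactions_in_support[of D] by (simp add: D)
  ultimately show ?thesis
  proof eventually_elim
    fix \<omega>
    assume al: "\<forall>m::nat. \<exists>t. aligned (1 / (real m + 1)) n (traj f U0 \<omega> t)" and \<omega>: "\<forall>t. \<omega> t \<in> Omega n"
    have "\<exists>t. aligned \<delta> n (traj f U0 \<omega> t)" if \<delta>: "0 < \<delta>" for \<delta>
    proof -
      obtain m where m: "1 / (real m + 1) < \<delta>" using nat_approx_posE[OF \<delta>] by (metis of_nat_Suc add.commute)
      obtain t where "aligned (1 / (real m + 1)) n (traj f U0 \<omega> t)" using al by blast
      then have "aligned \<delta> n (traj f U0 \<omega> t)" using m unfolding aligned_def by fastforce
      then show ?thesis by blast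
    qed
    then show "polarizes n (traj f U0 \<omega>)" using polarizes_if_aligned[OF f U0(1)] \<omega> n by simp
  qed
qed

end
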